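(* The following are provable in $\mathbf{ZF}$: (i) $\mathbf{A}(\sigma\sigma)\leftrightarrow\mathbf{A}(\delta\delta)$. (ii) $\mathbf{CMC}\rightarrow\mathbf{A}(\sigma\sigma)$. (iii) $\mathbf{A}(\sigma\sigma)\rightarrow\mathbf{CMC}_{\omega}$.
   Context: The base theory is $\mathbf{ZF}$ (no Axiom of Choice). A set is countable if it is equipotent to a subset of $\omega$, and denumerable if it is infinite and countable. A multiple choice function of a family $\{A_j:j\in J\}$ is a function assigning to each $j\in J$ a non-empty finite subset of $A_j$. $\mathbf{CMC}$: every denumerable family of non-empty sets has a multiple choice function. $\mathbf{CMC}_{\omega}$: every denumerable family of denumerable sets has a multiple choice function. A family $\mathcal{A}$ of sets is stable under finite unions (finite intersections) if $A_1\cup A_2\in\mathcal{A}$ (respectively $A_1\cap A_2\in\mathcal{A}$) for all $A_1,A_2\in\mathcal{A}$. $\mathbf{A}(\sigma\sigma)$ (respectively, $\mathbf{A}(\delta\delta)$): For every set $X$ and every family $\mathcal{A}$ of subsets of $X$ which is stable under finite unions and finite intersections, and for every family $\{\mathcal{U}_n:n\in\omega\}$ of non-empty countable subfamilies of $\mathcal{A}$, there exists a family $\{V_{n,m}:n,m\in\omega\}$ of members of $\mathcal{A}$ such that, for every $n\in\omega$, $\bigcup\mathcal{U}_n=\bigcup_{m\in\omega}V_{n,m}$ (respectively, $\bigcap\mathcal{U}_n=\bigcap_{m\in\omega}V_{n,m}$). *)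

theory Defs
  imports Main
begin

text \<open>
  HOL has a choice operator, so the choice principles below would be theorems of HOL if they
  were stated about HOL sets. They are therefore sentences of the first-order language of set
  theory, and ``provable in ZF'' is derivability of the sentence from the axioms of ZF in
  classical first-order logic with equality.
\<close>

section \<open>First-order logic over the signature with membership and equality\<close>

text \<open>Variables are de Bruijn indices. They are the only terms, so substitution is renaming.\<close>

datatype fm = Mem nat nat | Eq nat nat | Bot | Imp fm fm | All fm

abbreviation Neg :: "fm \<Rightarrow> fm" where "Neg p \<equiv> Imp p Bot"

definition lift :: "(nat \<Rightarrow> nat) \<Rightarrow> nat \<Rightarrow> nat" where
  "lift r = case_nat 0 (\<lambda>k. Suc (r k))"

primrec rename :: "(nat \<Rightarrow> nat) \<Rightarrow> fm \<Rightarrow> fm" where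
  "rename r (Mem i j) = Mem (r i) (r j)"
| "rename r (Eq i j) = Eq (r i) (r j)"
| "rename r Bot = Bot"
| "rename r (Imp p q) = Imp (rename r p) (rename r q)"
| "rename r (All p) = All (rename (lift r) p)"

text \<open>\<open>inst t p\<close> replaces index 0 by the variable \<open>t\<close> and lowers all other free indices by one.\<close>

definition inst :: "nat \<Rightarrow> fm \<Rightarrow> fm" where
  "inst t = rename (case_nat t (\<lambda>k. k))"

text \<open>
  Natural deduction. In \<open>AllI\<close>, renaming the hypotheses by \<open>Suc\<close> makes index 0 a fresh variable
  (eigenvariable condition).
\<close>

inductive derives :: "fm set \<Rightarrow> fm \<Rightarrow> bool" (infix "\<turnstile>" 50) where
  Assm: "p \<in> \<Gamma> \<Longrightarrow> \<Gamma> \<turnstile> p"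
| ImpI: "insert p \<Gamma> \<turnstile> q \<Longrightarrow> \<Gamma> \<turnstile> Imp p q"
| ImpE: "\<Gamma> \<turnstile> Imp p q \<Longrightarrow> \<Gamma> \<turnstile> p \<Longrightarrow> \<Gamma> \<turnstile> q"
| Classical: "insert (Neg p) \<Gamma> \<turnstile> Bot \<Longrightarrow> \<Gamma> \<turnstile> p"
| AllI: "rename Suc ` \<Gamma> \<turnstile> p \<Longrightarrow> \<Gamma> \<turnstile> All p"
| AllE: "\<Gamma> \<turnstile> All p \<Longrightarrow> \<Gamma> \<turnstile> inst t p"
| EqRefl: "\<Gamma> \<turnstile> Eq t t"
| EqSubst: "\<Gamma> \<turnstile> Eq s t \<Longrightarrow> \<Gamma> \<turnstile> inst s p \<Longrightarrow> \<Gamma> \<turnstile> inst t p"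

text \<open>All free indices of \<open>p\<close> are below \<open>fv_bound p\<close>.\<close>

primrec fv_bound :: "fm \<Rightarrow> nat" where
  "fv_bound (Mem i j) = Suc (max i j)"
| "fv_bound (Eq i j) = Suc (max i j)"
| "fv_bound Bot = 0"
| "fv_bound (Imp p q) = max (fv_bound p) (fv_bound q)"
| "fv_bound (All p) = fv_bound p - 1"

definition univ_closure :: "fm \<Rightarrow> fm" where
  "univ_closure p = (All ^^ fv_bound p) p"


section \<open>Readable formulas\<close>

text \<open>
  To write formulas with named bound variables, a \<open>form\<close> maps the number \<open>d\<close> of enclosing
  quantifiers to a de Bruijn formula, and a \<open>var\<close> maps it to the index denoting that variable there:
  the variable bound by the quantifier that has \<open>d\<close> quantifiers outside it has index \<open>d' - Suc d\<close>
  below \<open>d'\<close> quantifiers. The sentence written by \<open>P\<close> is \<open>P 0\<close>.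
\<close>

type_synonym var = "nat \<Rightarrow> nat"
type_synonym form = "nat \<Rightarrow> fm"

definition fMem :: "var \<Rightarrow> var \<Rightarrow> form" (infix "\<^bold>\<in>" 50) where
  "x \<^bold>\<in> y = (\<lambda>d. Mem (x d) (y d))"

definition fEq :: "var \<Rightarrow> var \<Rightarrow> form" (infix "\<^bold>=" 50) where
  "x \<^bold>= y = (\<lambda>d. Eq (x d) (y d))"

definition fImp :: "form \<Rightarrow> form \<Rightarrow> form" (infixr "\<^bold>\<longrightarrow>" 25) where
  "(P \<^bold>\<longrightarrow> Q) = (\<lambda>d. Imp (P d) (Q d))"

definition fNot :: "form \<Rightarrow> form" ("\<^bold>\<not> _" [40] 40) where
  "(\<^bold>\<not> P) = (\<lambda>d. Neg (P d))"

definition fAnd :: "form \<Rightarrow> form \<Rightarrow> form" (infixr "\<^bold>\<and>" 35) where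
  "(P \<^bold>\<and> Q) = (\<^bold>\<not> (P \<^bold>\<longrightarrow> \<^bold>\<not> Q))"

definition fOr :: "form \<Rightarrow> form \<Rightarrow> form" (infixr "\<^bold>\<or>" 30) where
  "(P \<^bold>\<or> Q) = (\<^bold>\<not> P \<^bold>\<longrightarrow> Q)"

definition fIff :: "form \<Rightarrow> form \<Rightarrow> form" (infixr "\<^bold>\<longleftrightarrow>" 25) where
  "(P \<^bold>\<longleftrightarrow> Q) = ((P \<^bold>\<longrightarrow> Q) \<^bold>\<and> (Q \<^bold>\<longrightarrow> P))"

definition fAll :: "(var \<Rightarrow> form) \<Rightarrow> form" (binder "\<^bold>\<forall>" 10) where
  "fAll P = (\<lambda>d. All (P (\<lambda>d'. d' - Suc d) (Suc d)))"

definition fEx :: "(var \<Rightarrow> form) \<Rightarrow> form" (binder "\<^bold>\<exists>" 10) where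
  "fEx P = (\<^bold>\<not> (\<^bold>\<forall>x. \<^bold>\<not> P x))"

definition fEx1 :: "(var \<Rightarrow> form) \<Rightarrow> form" (binder "\<^bold>\<exists>\<^bold>!" 10) where
  "fEx1 P = (\<^bold>\<exists>x. P x \<^bold>\<and> (\<^bold>\<forall>y. P y \<^bold>\<longrightarrow> y \<^bold>= x))"

lemma "(\<^bold>\<forall>x. \<^bold>\<forall>y. y \<^bold>\<in> x \<^bold>\<longrightarrow> (\<^bold>\<forall>z. x \<^bold>\<in> z)) 0 = All (All (Imp (Mem 0 1) (All (Mem 2 0))))"
  by (simp add: fAll_def fImp_def fMem_def)

text \<open>
  The instance \<open>\<phi>(x)\<close>, resp. \<open>\<phi>(x, y)\<close>, of an arbitrary formula \<open>\<phi>\<close> for the axiom schemas: its first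
  one (two) free indices are the arguments, and the remaining ones are parameters, which stay free.
\<close>

definition app1 :: "fm \<Rightarrow> var \<Rightarrow> form" where
  "app1 \<phi> x = (\<lambda>d. rename (case_nat (x d) (\<lambda>k. k + d)) \<phi>)"

definition app2 :: "fm \<Rightarrow> var \<Rightarrow> var \<Rightarrow> form" where
  "app2 \<phi> x y = (\<lambda>d. rename (case_nat (x d) (case_nat (y d) (\<lambda>k. k + d))) \<phi>)"


section \<open>Basic set-theoretic notions\<close>

definition is_empty :: "var \<Rightarrow> form" where
  "is_empty x = (\<^bold>\<forall>z. \<^bold>\<not> z \<^bold>\<in> x)"

definition is_nonempty :: "var \<Rightarrow> form" where
  "is_nonempty x = (\<^bold>\<exists>z. z \<^bold>\<in> x)"

definition is_subset :: "var \<Rightarrow> var \<Rightarrow> form" (infix "\<^bold>\<subseteq>" 50) where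
  "x \<^bold>\<subseteq> y = (\<^bold>\<forall>z. z \<^bold>\<in> x \<^bold>\<longrightarrow> z \<^bold>\<in> y)"

definition is_upair :: "var \<Rightarrow> var \<Rightarrow> var \<Rightarrow> form" where
  "is_upair z x y = (\<^bold>\<forall>w. w \<^bold>\<in> z \<^bold>\<longleftrightarrow> w \<^bold>= x \<^bold>\<or> w \<^bold>= y)"

text \<open>Kuratowski pairs: \<open>p = {{x}, {x, y}}\<close>.\<close>

definition is_pair :: "var \<Rightarrow> var \<Rightarrow> var \<Rightarrow> form" where
  "is_pair p x y = (\<^bold>\<forall>w. w \<^bold>\<in> p \<^bold>\<longleftrightarrow> is_upair w x x \<^bold>\<or> is_upair w x y)"

definition is_un :: "var \<Rightarrow> var \<Rightarrow> var \<Rightarrow> form" where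
  "is_un z x y = (\<^bold>\<forall>w. w \<^bold>\<in> z \<^bold>\<longleftrightarrow> w \<^bold>\<in> x \<^bold>\<or> w \<^bold>\<in> y)"

definition is_int :: "var \<Rightarrow> var \<Rightarrow> var \<Rightarrow> form" where
  "is_int z x y = (\<^bold>\<forall>w. w \<^bold>\<in> z \<^bold>\<longleftrightarrow> w \<^bold>\<in> x \<^bold>\<and> w \<^bold>\<in> y)"

definition is_Union :: "var \<Rightarrow> var \<Rightarrow> form" where
  "is_Union z x = (\<^bold>\<forall>w. w \<^bold>\<in> z \<^bold>\<longleftrightarrow> (\<^bold>\<exists>y. y \<^bold>\<in> x \<^bold>\<and> w \<^bold>\<in> y))"

text \<open>\<open>z = \<Inter>x\<close>; only used for non-empty \<open>x\<close>.\<close>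

definition is_Inter :: "var \<Rightarrow> var \<Rightarrow> form" where
  "is_Inter z x = (\<^bold>\<forall>w. w \<^bold>\<in> z \<^bold>\<longleftrightarrow> (\<^bold>\<forall>y. y \<^bold>\<in> x \<^bold>\<longrightarrow> w \<^bold>\<in> y))"

definition is_succ :: "var \<Rightarrow> var \<Rightarrow> form" where
  "is_succ z x = (\<^bold>\<forall>w. w \<^bold>\<in> z \<^bold>\<longleftrightarrow> w \<^bold>\<in> x \<^bold>\<or> w \<^bold>= x)"

definition is_inductive :: "var \<Rightarrow> form" where
  "is_inductive w = ((\<^bold>\<exists>e. is_empty e \<^bold>\<and> e \<^bold>\<in> w) \<^bold>\<and>
     (\<^bold>\<forall>x. x \<^bold>\<in> w \<^bold>\<longrightarrow> (\<^bold>\<exists>y. is_succ y x \<^bold>\<and> y \<^bold>\<in> w)))"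

definition is_omega :: "var \<Rightarrow> form" where
  "is_omega w = (is_inductive w \<^bold>\<and> (\<^bold>\<forall>v. is_inductive v \<^bold>\<longrightarrow> w \<^bold>\<subseteq> v))"

definition is_prod :: "var \<Rightarrow> var \<Rightarrow> var \<Rightarrow> form" where
  "is_prod p a b = (\<^bold>\<forall>q. q \<^bold>\<in> p \<^bold>\<longleftrightarrow> (\<^bold>\<exists>x. \<^bold>\<exists>y. x \<^bold>\<in> a \<^bold>\<and> y \<^bold>\<in> b \<^bold>\<and> is_pair q x y))"

text \<open>\<open>maps_to f x y\<close> says that the pair of \<open>x\<close> and \<open>y\<close> is in \<open>f\<close>, i.e. \<open>f(x) = y\<close> for a function \<open>f\<close>.\<close>

definition maps_to :: "var \<Rightarrow> var \<Rightarrow> var \<Rightarrow> form" where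
  "maps_to f x y = (\<^bold>\<exists>p. is_pair p x y \<^bold>\<and> p \<^bold>\<in> f)"

text \<open>\<open>f\<close> is a function with domain \<open>a\<close>, i.e. a family indexed by \<open>a\<close>.\<close>

definition fun_on :: "var \<Rightarrow> var \<Rightarrow> form" where
  "fun_on f a = ((\<^bold>\<forall>p. p \<^bold>\<in> f \<^bold>\<longrightarrow> (\<^bold>\<exists>x. \<^bold>\<exists>y. x \<^bold>\<in> a \<^bold>\<and> is_pair p x y)) \<^bold>\<and>
     (\<^bold>\<forall>x. x \<^bold>\<in> a \<^bold>\<longrightarrow> (\<^bold>\<exists>\<^bold>!y. maps_to f x y)))"

definition fun_into :: "var \<Rightarrow> var \<Rightarrow> var \<Rightarrow> form" where
  "fun_into f a b = (fun_on f a \<^bold>\<and> (\<^bold>\<forall>x. \<^bold>\<forall>y. maps_to f x y \<^bold>\<longrightarrow> y \<^bold>\<in> b))"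

definition bijection :: "var \<Rightarrow> var \<Rightarrow> var \<Rightarrow> form" where
  "bijection f a b = (fun_into f a b \<^bold>\<and> (\<^bold>\<forall>y. y \<^bold>\<in> b \<^bold>\<longrightarrow> (\<^bold>\<exists>\<^bold>!x. maps_to f x y)))"

definition equipotent :: "var \<Rightarrow> var \<Rightarrow> form" where
  "equipotent a b = (\<^bold>\<exists>f. bijection f a b)"

definition is_finite :: "var \<Rightarrow> form" where
  "is_finite x = (\<^bold>\<exists>w. \<^bold>\<exists>n. is_omega w \<^bold>\<and> n \<^bold>\<in> w \<^bold>\<and> equipotent x n)"

definition is_countable :: "var \<Rightarrow> form" where
  "is_countable x = (\<^bold>\<exists>w. \<^bold>\<exists>s. is_omega w \<^bold>\<and> s \<^bold>\<subseteq> w \<^bold>\<and> equipotent x s)"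

definition is_denumerable :: "var \<Rightarrow> form" where
  "is_denumerable x = (\<^bold>\<not> is_finite x \<^bold>\<and> is_countable x)"


section \<open>The axioms of ZF\<close>

definition ax_extensionality :: form where
  "ax_extensionality = (\<^bold>\<forall>x. \<^bold>\<forall>y. (\<^bold>\<forall>z. z \<^bold>\<in> x \<^bold>\<longleftrightarrow> z \<^bold>\<in> y) \<^bold>\<longrightarrow> x \<^bold>= y)"

definition ax_foundation :: form where
  "ax_foundation = (\<^bold>\<forall>x. is_nonempty x \<^bold>\<longrightarrow> (\<^bold>\<exists>y. y \<^bold>\<in> x \<^bold>\<and> \<^bold>\<not> (\<^bold>\<exists>z. z \<^bold>\<in> x \<^bold>\<and> z \<^bold>\<in> y)))"

definition ax_pairing :: form where
  "ax_pairing = (\<^bold>\<forall>x. \<^bold>\<forall>y. \<^bold>\<exists>z. is_upair z x y)"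

definition ax_union :: form where
  "ax_union = (\<^bold>\<forall>x. \<^bold>\<exists>z. is_Union z x)"

definition ax_power :: form where
  "ax_power = (\<^bold>\<forall>x. \<^bold>\<exists>p. \<^bold>\<forall>y. y \<^bold>\<in> p \<^bold>\<longleftrightarrow> y \<^bold>\<subseteq> x)"

definition ax_infinity :: form where
  "ax_infinity = (\<^bold>\<exists>w. is_inductive w)"

definition ax_separation :: "fm \<Rightarrow> form" where
  "ax_separation \<phi> = (\<^bold>\<forall>a. \<^bold>\<exists>b. \<^bold>\<forall>x. x \<^bold>\<in> b \<^bold>\<longleftrightarrow> x \<^bold>\<in> a \<^bold>\<and> app1 \<phi> x)"

definition ax_replacement :: "fm \<Rightarrow> form" where
  "ax_replacement \<phi> = (\<^bold>\<forall>a.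
     (\<^bold>\<forall>x. x \<^bold>\<in> a \<^bold>\<longrightarrow> (\<^bold>\<forall>y. \<^bold>\<forall>z. app2 \<phi> x y \<^bold>\<and> app2 \<phi> x z \<^bold>\<longrightarrow> y \<^bold>= z)) \<^bold>\<longrightarrow>
     (\<^bold>\<exists>b. \<^bold>\<forall>y. y \<^bold>\<in> b \<^bold>\<longleftrightarrow> (\<^bold>\<exists>x. x \<^bold>\<in> a \<^bold>\<and> app2 \<phi> x y)))"

definition ZF :: "fm set" where
  "ZF = {ax_extensionality 0, ax_foundation 0, ax_pairing 0, ax_union 0, ax_power 0, ax_infinity 0}
      \<union> {univ_closure (ax_separation \<phi> 0) | \<phi>. True}
      \<union> {univ_closure (ax_replacement \<phi> 0) | \<phi>. True}"


section \<open>The choice principles\<close>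

text \<open>\<open>C\<close> is a multiple choice function of the family \<open>F\<close> indexed by \<open>J\<close>.\<close>

definition multiple_choice_fun :: "var \<Rightarrow> var \<Rightarrow> var \<Rightarrow> form" where
  "multiple_choice_fun C F J = (fun_on C J \<^bold>\<and>
     (\<^bold>\<forall>j. \<^bold>\<forall>A. \<^bold>\<forall>B. maps_to F j A \<^bold>\<and> maps_to C j B \<^bold>\<longrightarrow> is_nonempty B \<^bold>\<and> is_finite B \<^bold>\<and> B \<^bold>\<subseteq> A))"

definition CMC :: form where
  "CMC = (\<^bold>\<forall>J. \<^bold>\<forall>F. is_denumerable J \<^bold>\<and> fun_on F J \<^bold>\<and> (\<^bold>\<forall>j. \<^bold>\<forall>A. maps_to F j A \<^bold>\<longrightarrow> is_nonempty A) \<^bold>\<longrightarrow>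
     (\<^bold>\<exists>C. multiple_choice_fun C F J))"

definition CMC_omega :: form where
  "CMC_omega = (\<^bold>\<forall>J. \<^bold>\<forall>F. is_denumerable J \<^bold>\<and> fun_on F J \<^bold>\<and>
       (\<^bold>\<forall>j. \<^bold>\<forall>A. maps_to F j A \<^bold>\<longrightarrow> is_denumerable A) \<^bold>\<longrightarrow>
     (\<^bold>\<exists>C. multiple_choice_fun C F J))"

definition stable_un :: "var \<Rightarrow> form" where
  "stable_un \<A> = (\<^bold>\<forall>A. \<^bold>\<forall>B. A \<^bold>\<in> \<A> \<^bold>\<and> B \<^bold>\<in> \<A> \<^bold>\<longrightarrow> (\<^bold>\<exists>C. is_un C A B \<^bold>\<and> C \<^bold>\<in> \<A>))"

definition stable_int :: "var \<Rightarrow> form" where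
  "stable_int \<A> = (\<^bold>\<forall>A. \<^bold>\<forall>B. A \<^bold>\<in> \<A> \<^bold>\<and> B \<^bold>\<in> \<A> \<^bold>\<longrightarrow> (\<^bold>\<exists>C. is_int C A B \<^bold>\<and> C \<^bold>\<in> \<A>))"

text \<open>\<open>R\<close> is the \<open>n\<close>-th row \<open>{V(n, m) | m \<in> w}\<close> of the doubly indexed family \<open>V\<close>.\<close>

definition is_row :: "var \<Rightarrow> var \<Rightarrow> var \<Rightarrow> var \<Rightarrow> form" where
  "is_row R V n w = (\<^bold>\<forall>v. v \<^bold>\<in> R \<^bold>\<longleftrightarrow> (\<^bold>\<exists>m. \<^bold>\<exists>q. m \<^bold>\<in> w \<^bold>\<and> is_pair q n m \<^bold>\<and> maps_to V q v))"

text \<open>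
  The common form of \<open>A(\<sigma>\<sigma>)\<close> and \<open>A(\<delta>\<delta>)\<close>; \<open>Op S x\<close> says that \<open>S\<close> is the union, resp. the
  intersection, of \<open>x\<close>, and \<open>w\<close> is \<open>\<omega>\<close>.
\<close>

definition A_principle :: "(var \<Rightarrow> var \<Rightarrow> form) \<Rightarrow> form" where
  "A_principle Op = (\<^bold>\<forall>w. \<^bold>\<forall>X. \<^bold>\<forall>\<A>. \<^bold>\<forall>U.
     is_omega w \<^bold>\<and>
     (\<^bold>\<forall>A. A \<^bold>\<in> \<A> \<^bold>\<longrightarrow> A \<^bold>\<subseteq> X) \<^bold>\<and> stable_un \<A> \<^bold>\<and> stable_int \<A> \<^bold>\<and>
     fun_on U w \<^bold>\<and> (\<^bold>\<forall>n. \<^bold>\<forall>u. maps_to U n u \<^bold>\<longrightarrow> is_nonempty u \<^bold>\<and> is_countable u \<^bold>\<and> u \<^bold>\<subseteq> \<A>) \<^bold>\<longrightarrow>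
     (\<^bold>\<exists>V. (\<^bold>\<exists>P. is_prod P w w \<^bold>\<and> fun_into V P \<A>) \<^bold>\<and>
       (\<^bold>\<forall>n. \<^bold>\<forall>u. maps_to U n u \<^bold>\<longrightarrow> (\<^bold>\<exists>R. \<^bold>\<exists>S. is_row R V n w \<^bold>\<and> Op S u \<^bold>\<and> Op S R))))"

definition A_sigma_sigma :: form where
  "A_sigma_sigma = A_principle is_Union"

definition A_delta_delta :: form where
  "A_delta_delta = A_principle is_Inter"

end

theory Submission
  imports Defs "HOL-Library.Countable_Set"
begin

text \<open>
  By completeness of first-order logic, it suffices to argue in an arbitrary model of ZF, where
  separation and replacement are available for all predicates definable with parameters.

  (i) Taking complements relative to \<open>X\<close> exchanges unions and intersections.
  (ii) The enumerations \<open>f : \<omega> \<rightarrow> U\<^sub>n\<close> form a nonempty set, so CMC gives nonempty finite sets \<open>C\<^sub>n\<close>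
  of enumerations, and \<open>V\<^sub>n\<^sub>,\<^sub>m\<close> is the union of the finitely many sets \<open>f(m)\<close> with \<open>f \<in> C\<^sub>n\<close>.
  (iii) Enumerate the index set as \<open>j\<^sub>0, j\<^sub>1, \<dots>\<close>, possibly with repetitions, and apply \<open>A(\<sigma>\<sigma>)\<close>
  to the lattice of finite subsets of \<open>\<Union>\<^sub>j F(j)\<close> and the families of singletons
  \<open>U\<^sub>n = {{x} | x \<in> F(j\<^sub>n)}\<close>. The first nonempty \<open>V\<^sub>n\<^sub>,\<^sub>m\<close> is a finite subset of \<open>F(j\<^sub>n)\<close>.
\<close>


section \<open>Renaming and derivations\<close>

text \<open>Two gaps separate completeness from models in which HOL reasoning is comfortable. The
  Henkin model lives on variable indices and interprets equality only as a congruence; its quotient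
  must again be a structure on \<open>nat\<close>, which works because a model of ZF has infinitely
  many classes. Inside a model, HOL functions and predicates yield sets only when they are
  definable, so closure rules for definability (\<open>definable_intros\<close>) accompany every
  construction. HOL may supply fixed objects as parameters, but not a sequence of choices: in (ii)
  an enumeration exists for each n separately, and only the set of all enumerations depends
  definably on n; in (iii) first indices are used because a minimum is definable. Moreover, the
  model may contain nonstandard natural numbers, so its finite sets need not be finite in HOL, and
  every induction over numbers or finite sets must be for a definable predicate.\<close>

lemma rename_cong: "(\<And>i. i < fv_bound p \<Longrightarrow> r i = s i) \<Longrightarrow> rename r p = rename s p"
proof (induction p arbitrary: r s)
  case (All p)
  have "lift r i = lift s i" if "i < fv_bound p" for i
    using All.prems that by (cases i) (auto simp: lift_def)
  then show ?case by (simp add: All.IH[of "lift r" "lift s"])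
next
  case (Imp p q)
  show ?case using Imp.IH[of r s] Imp.prems by simp
qed (simp_all add: less_max_iff_disj)

lemma rename_rename: "rename r (rename s p) = rename (r \<circ> s) p"
proof (induction p arbitrary: r s)
  case (All p)
  have "lift r \<circ> lift s = lift (r \<circ> s)"
    by (auto simp: lift_def fun_eq_iff split: nat.split)
  then show ?case unfolding rename.simps All.IH by (rule arg_cong)
qed auto

lemma rename_id: "rename id p = p"
proof (induction p)
  case (All p)
  have "lift id = id" by (auto simp: lift_def fun_eq_iff split: nat.split)
  with All show ?case by (simp only: rename.simps)
qed auto

lemma rename_inst: "rename r (inst t p) = inst (r t) (rename (lift r) p)"
  unfolding inst_def rename_rename
  by (rule rename_cong) (auto simp: lift_def split: nat.split)

lemma rename_lift_Suc: "rename (lift r) (rename Suc p) = rename Suc (rename r p)"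
  unfolding rename_rename by (rule rename_cong) (auto simp: lift_def)

lemma inst_rename_lift: "inst t (rename (lift r) p) = rename (case_nat t r) p"
  unfolding inst_def rename_rename
  by (rule rename_cong) (auto simp: lift_def split: nat.split)

lemma derives_mono: "\<Gamma> \<turnstile> p \<Longrightarrow> \<Gamma> \<subseteq> \<Delta> \<Longrightarrow> \<Delta> \<turnstile> p"
proof (induction arbitrary: \<Delta> rule: derives.induct)
  case (ImpI p \<Gamma> q)
  then show ?case by (metis derives.ImpI insert_mono)
next
  case (Classical p \<Gamma>)
  then show ?case by (metis derives.Classical insert_mono)
next
  case (AllI \<Gamma> p)
  then show ?case by (metis derives.AllI image_mono)
next
  case (Assm p \<Gamma>)
  then show ?case by (blast intro: derives.Assm)
next
  case (ImpE \<Gamma> p q)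
  then show ?case using derives.ImpE by blast
next
  case (AllE \<Gamma> p t)
  then show ?case by (simp add: derives.AllE)
next
  case (EqRefl \<Gamma> t)
  then show ?case by (simp add: derives.EqRefl)
next
  case (EqSubst \<Gamma> s t p)
  then show ?case using derives.EqSubst by metis
qed

text \<open>Compactness, needed for the consistency of the limit of the Henkin stages; each rule
  joins the finite sets of its premises.\<close>

lemma derives_finite: "\<Gamma> \<turnstile> p \<Longrightarrow> \<exists>\<Gamma>'. finite \<Gamma>' \<and> \<Gamma>' \<subseteq> \<Gamma> \<and> \<Gamma>' \<turnstile> p"
proof (induction rule: derives.induct)
  case (Assm p \<Gamma>)
  then show ?case by (intro exI[of _ "{p}"]) (auto intro: derives.Assm)
next
  case (ImpI p \<Gamma> q)
  then obtain G where "finite G" "G \<subseteq> insert p \<Gamma>" "G \<turnstile> q" by blast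
  then show ?case
    by (intro exI[of _ "G - {p}"] conjI derives.ImpI[OF derives_mono[OF \<open>G \<turnstile> q\<close>]]) auto
next
  case (ImpE \<Gamma> p q)
  then obtain G H where "finite G" "G \<subseteq> \<Gamma>" "G \<turnstile> Imp p q" "finite H" "H \<subseteq> \<Gamma>" "H \<turnstile> p" by blast
  then show ?case
    by (intro exI[of _ "G \<union> H"] conjI
        derives.ImpE[OF derives_mono[OF \<open>G \<turnstile> Imp p q\<close>] derives_mono[OF \<open>H \<turnstile> p\<close>]]) auto
next
  case (Classical p \<Gamma>)
  then obtain G where "finite G" "G \<subseteq> insert (Neg p) \<Gamma>" "G \<turnstile> Bot" by blast
  then show ?case
    by (intro exI[of _ "G - {Neg p}"] conjI derives.Classical[OF derives_mono[OF \<open>G \<turnstile> Bot\<close>]]) auto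
next
  case (AllI \<Gamma> p)
  then obtain G where "finite G" "G \<subseteq> rename Suc ` \<Gamma>" "G \<turnstile> p" by blast
  then show ?case by (metis derives.AllI finite_subset_image)
next
  case (EqSubst \<Gamma> s t p)
  then obtain G H where "finite G" "G \<subseteq> \<Gamma>" "G \<turnstile> Eq s t" "finite H" "H \<subseteq> \<Gamma>" "H \<turnstile> inst s p" by blast
  then show ?case
    by (intro exI[of _ "G \<union> H"] conjI
        derives.EqSubst[OF derives_mono[OF \<open>G \<turnstile> Eq s t\<close>] derives_mono[OF \<open>H \<turnstile> inst s p\<close>]]) auto
next
  case (AllE \<Gamma> p t)
  then show ?case using derives.AllE by blast
next
  case (EqRefl \<Gamma> t)
  then show ?case using derives.EqRefl by blast
qed

text \<open>The renaming stays arbitrary in the induction because passing under a quantifier turns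
  \<open>r\<close> into \<open>lift r\<close>; its commutation with \<open>Suc\<close>
  (\<open>rename_lift_Suc\<close>) preserves the eigenvariable condition.\<close>

lemma derives_rename: "\<Gamma> \<turnstile> p \<Longrightarrow> rename r ` \<Gamma> \<turnstile> rename r p"
proof (induction arbitrary: r rule: derives.induct)
  case (ImpI p \<Gamma> q)
  then show ?case by (simp add: derives.ImpI)
next
  case (ImpE \<Gamma> p q)
  from ImpE.IH[of r] show ?case by (metis derives.ImpE rename.simps(4))
next
  case (Classical p \<Gamma>)
  from Classical.IH[of r] show ?case by (simp add: derives.Classical)
next
  case (AllI \<Gamma> p)
  from AllI.IH[of "lift r"] show ?case
    by (simp add: derives.AllI image_image rename_lift_Suc)
next
  case (AllE \<Gamma> p t)
  from AllE.IH[of r] show ?case by (simp add: derives.AllE rename_inst)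
next
  case (EqSubst \<Gamma> s t p)
  from EqSubst.IH[of r] show ?case by (metis derives.EqSubst rename.simps(2) rename_inst)
next
  case (EqRefl \<Gamma> t)
  then show ?case by (simp add: derives.EqRefl)
qed (blast intro: derives.Assm)

text \<open>Index \<open>c\<close> lies above every free index in sight, so it acts as a new
  constant. Renaming \<open>c\<close> to 0 and shifting all else by one undoes the instantiation and
  turns the hypotheses into the shifted ones that \<open>AllI\<close> expects.\<close>

lemma derives_All_fresh:
  assumes "\<Gamma> \<turnstile> inst c p" and "\<And>q. q \<in> \<Gamma> \<Longrightarrow> fv_bound q \<le> c" and "fv_bound (All p) \<le> c"
  shows "\<Gamma> \<turnstile> All p"
proof (rule derives.AllI)
  let ?r = "\<lambda>k. if k = c then 0 else Suc k"
  have "rename ?r (inst c p) = rename id p"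
    unfolding inst_def rename_rename
    by (rule rename_cong) (use assms(3) in \<open>auto split: nat.split\<close>)
  also have "\<dots> = p" by (rule rename_id)
  finally have 1: "rename ?r (inst c p) = p" .
  have "rename ?r q = rename Suc q" if "q \<in> \<Gamma>" for q
    by (rule rename_cong) (use assms(2)[OF that] in auto)
  then have "rename ?r ` \<Gamma> = rename Suc ` \<Gamma>" by (rule image_cong[OF refl])
  then show "rename Suc ` \<Gamma> \<turnstile> p" using derives_rename[OF assms(1), of ?r] 1 by simp
qed

lemma derives_cut: "\<Gamma> \<turnstile> p \<Longrightarrow> insert p \<Gamma> \<turnstile> q \<Longrightarrow> \<Gamma> \<turnstile> q"
  using derives.ImpI derives.ImpE by blast


section \<open>Henkin's completeness theorem\<close>

text \<open>Equality is interpreted by an arbitrary relation \<open>Q\<close>, since the term model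
  at first reads it as membership of \<open>Eq i j\<close> in the Henkin set rather than as
  identity.\<close>

primrec sat :: "('a \<Rightarrow> 'a \<Rightarrow> bool) \<Rightarrow> ('a \<Rightarrow> 'a \<Rightarrow> bool) \<Rightarrow> (nat \<Rightarrow> 'a) \<Rightarrow> fm \<Rightarrow> bool" where
  "sat E Q e (Mem i j) = E (e i) (e j)"
| "sat E Q e (Eq i j) = Q (e i) (e j)"
| "sat E Q e Bot = False"
| "sat E Q e (Imp p q) = (sat E Q e p \<longrightarrow> sat E Q e q)"
| "sat E Q e (All p) = (\<forall>a. sat E Q (case_nat a e) p)"

lemma sat_rename: "sat E Q e (rename r p) = sat E Q (\<lambda>k. e (r k)) p"
proof (induction p arbitrary: e r)
  case (All p)
  have "(\<lambda>k. case_nat a e (lift r k)) = case_nat a (\<lambda>k. e (r k))" for a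
    by (auto simp: lift_def fun_eq_iff split: nat.split)
  then show ?case by (simp only: rename.simps sat.simps All.IH)
qed (auto simp: comp_def)

lemma sat_cong: "(\<And>i. i < fv_bound p \<Longrightarrow> e i = e' i) \<Longrightarrow> sat E Q e p = sat E Q e' p"
proof (induction p arbitrary: e e')
  case (All p)
  have "sat E Q (case_nat a e) p = sat E Q (case_nat a e') p" for a
    by (rule All.IH) (use All.prems in \<open>auto split: nat.split\<close>)
  then show ?case by simp
next
  case (Imp p q)
  show ?case using Imp.IH[of e e'] Imp.prems by simp
qed (simp_all add: less_max_iff_disj)

section \<open>Extending a closed theory to a maximal consistent set with witnesses\<close>

instance fm :: countable
  by countable_datatype

definition consistent :: "fm set \<Rightarrow> bool" where
  "consistent S \<longleftrightarrow> \<not> S \<turnstile> Bot"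

text \<open>If the counterexample at the fresh index \<open>c\<close> were refutable,
  \<open>S\<close> would prove the instance at \<open>c\<close>, hence the universal formula itself,
  whose negation is in \<open>S\<close>.\<close>

lemma consistent_witness:
  assumes "consistent S" and "Neg (All q) \<in> S" and "\<And>p. p \<in> S \<Longrightarrow> fv_bound p \<le> c"
  shows "consistent (insert (Neg (inst c q)) S)"
  unfolding consistent_def
proof
  assume "insert (Neg (inst c q)) S \<turnstile> Bot"
  then have "S \<turnstile> inst c q" by (rule derives.Classical)
  then have "S \<turnstile> All q"
    using assms(2,3) by (intro derives_All_fresh) force+
  with assms(1,2) show False
    unfolding consistent_def using derives.Assm derives.ImpE by blast
qed

text \<open>A closed theory leaves all free indices unused, so they serve as the Henkin constants.\<close>

primrec henkin :: "fm set \<Rightarrow> nat \<Rightarrow> fm set" where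
  "henkin T 0 = T"
| "henkin T (Suc n) =
    (let p = from_nat n; S = insert p (henkin T n); c = (SOME c. \<forall>q\<in>S. fv_bound q \<le> c)
     in if consistent S then S \<union> {Neg (inst c q) | q. p = Neg (All q)} else henkin T n)"

lemma henkin_fv_bound:
  assumes "\<And>p. p \<in> T \<Longrightarrow> fv_bound p = 0"
  shows "\<exists>c. \<forall>q\<in>henkin T n. fv_bound q \<le> c"
proof (induction n)
  case 0
  then show ?case using assms by auto
next
  case (Suc n)
  then obtain c where c: "\<forall>q\<in>henkin T n. fv_bound q \<le> c" by blast
  define S where "S = insert (from_nat n) (henkin T n)"
  define d where "d = (SOME c. \<forall>q\<in>S. fv_bound q \<le> c)"
  have sub: "henkin T (Suc n) \<subseteq> S \<union> {Neg (inst d q) | q. from_nat n = Neg (All q)}"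
    by (auto simp: Let_def S_def d_def)
  \<comment> \<open>At most one \<open>q\<close> fits the shape of the current formula, so a single
    bound suffices.\<close>
  have "\<exists>k. \<forall>q. from_nat n = Neg (All q) \<longrightarrow> fv_bound (Neg (inst d q)) \<le> k"
    by (cases "\<exists>q. from_nat n = Neg (All q)") auto
  then obtain k where k: "\<forall>q. from_nat n = Neg (All q) \<longrightarrow> fv_bound (Neg (inst d q)) \<le> k"
    by blast
  have "fv_bound q \<le> max (max c k) (fv_bound (from_nat n))" if "q \<in> henkin T (Suc n)" for q
    using subsetD[OF sub that] c k by (auto simp: S_def le_max_iff_disj)
  then show ?case by blast
qed

lemma henkin_consistent:
  assumes "\<And>p. p \<in> T \<Longrightarrow> fv_bound p = 0" and "consistent T"
  shows "consistent (henkin T n)"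
proof (induction n)
  case 0
  then show ?case using assms by simp
next
  case (Suc n)
  define S where "S = insert (from_nat n) (henkin T n)"
  define d where "d = (SOME c. \<forall>q\<in>S. fv_bound q \<le> c)"
  obtain c where "\<forall>q\<in>henkin T n. fv_bound q \<le> c"
    using henkin_fv_bound assms(1) by blast
  then have "\<exists>c. \<forall>q\<in>S. fv_bound q \<le> c"
    unfolding S_def by (intro exI[of _ "max c (fv_bound (from_nat n))"]) (auto simp: le_max_iff_disj)
  then have d: "\<forall>q\<in>S. fv_bound q \<le> d" unfolding d_def by (rule someI_ex)
  have eq: "henkin T (Suc n) = (if consistent S
      then S \<union> {Neg (inst d q) | q. from_nat n = Neg (All q)} else henkin T n)"
    by (simp add: Let_def S_def d_def)
  show ?case
  proof (cases "consistent S \<and> (\<exists>q. from_nat n = Neg (All q))")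
    case True
    then obtain q where q: "from_nat n = Neg (All q)" by blast
    then have "henkin T (Suc n) = insert (Neg (inst d q)) S" using True eq by auto
    moreover have "consistent (insert (Neg (inst d q)) S)"
      by (rule consistent_witness) (use True q d in \<open>auto simp: S_def\<close>)
    ultimately show ?thesis by simp
  next
    case False
    then show ?thesis using eq Suc by auto
  qed
qed

lemma henkin_mono: "m \<le> n \<Longrightarrow> henkin T m \<subseteq> henkin T n"
  by (induction n rule: dec_induct) (auto simp: Let_def)

section \<open>The term model and its truth lemma\<close>

locale henkin_set =
  fixes H :: "fm set"
  assumes consistent: "consistent H"
    and maximal: "consistent (insert p H) \<Longrightarrow> p \<in> H"
    and witness: "Neg (All q) \<in> H \<Longrightarrow> \<exists>c. Neg (inst c q) \<in> H"
begin

text \<open>By cut, a derivable formula can be added consistently, so maximality puts it into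
  \<open>H\<close>.\<close>

lemma derives_iff: "H \<turnstile> p \<longleftrightarrow> p \<in> H"
  using consistent maximal derives_cut derives.Assm unfolding consistent_def by metis

lemma Neg_iff: "Neg p \<in> H \<longleftrightarrow> p \<notin> H"
  using derives_iff derives.ImpE derives.Classical maximal consistent
  unfolding consistent_def by metis

lemma Imp_iff: "Imp p q \<in> H \<longleftrightarrow> (p \<in> H \<longrightarrow> q \<in> H)"
proof
  assume "Imp p q \<in> H"
  then show "p \<in> H \<longrightarrow> q \<in> H" using derives_iff derives.ImpE by metis
next
  assume *: "p \<in> H \<longrightarrow> q \<in> H"
  have "insert p H \<turnstile> q"
  proof (cases "p \<in> H")
    case True
    then show ?thesis using * by (simp add: derives.Assm)
  next
    case False
    then have "Neg p \<in> H" by (simp add: Neg_iff)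
    then have "insert (Neg q) (insert p H) \<turnstile> Bot"
      by (intro derives.ImpE[of _ p Bot] derives.Assm) auto
    then show ?thesis by (rule derives.Classical)
  qed
  then show "Imp p q \<in> H" using derives.ImpI derives_iff by blast
qed

lemma All_iff: "All p \<in> H \<longleftrightarrow> (\<forall>c. inst c p \<in> H)"
  using derives_iff derives.AllE Neg_iff witness by metis

lemma Eq_refl: "Eq i i \<in> H"
  using derives_iff derives.EqRefl by blast

lemma Eq_subst: "Eq i j \<in> H \<Longrightarrow> inst i p \<in> H \<Longrightarrow> inst j p \<in> H"
  using derives_iff derives.EqSubst by blast

text \<open>Leibniz substitution into a template: index 0 marks the place to be replaced, and every
  other variable is written one higher because \<open>inst\<close> lowers it. Transitivity and
  congruence below follow the same pattern.\<close>

lemma Eq_sym: "Eq i j \<in> H \<Longrightarrow> Eq j i \<in> H"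
  using Eq_subst[of i j "Eq 0 (Suc i)"] Eq_refl by (simp add: inst_def)

lemma Eq_trans: "Eq i j \<in> H \<Longrightarrow> Eq j k \<in> H \<Longrightarrow> Eq i k \<in> H"
  using Eq_subst[of j k "Eq (Suc i) 0"] by (simp add: inst_def)

lemma Mem_cong: "Eq i i' \<in> H \<Longrightarrow> Eq j j' \<in> H \<Longrightarrow> Mem i j \<in> H \<Longrightarrow> Mem i' j' \<in> H"
  using Eq_subst[of i i' "Mem 0 (Suc j)"] Eq_subst[of j j' "Mem (Suc i') 0"]
  by (simp add: inst_def)

text \<open>The universe consists of the indices themselves, so an assignment is a renaming. Keeping
  \<open>r\<close> arbitrary lets the quantifier case extend it by any index, via
  \<open>inst_rename_lift\<close>.\<close>

lemma truth: "sat (\<lambda>i j. Mem i j \<in> H) (\<lambda>i j. Eq i j \<in> H) r p \<longleftrightarrow> rename r p \<in> H"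
proof (induction p arbitrary: r)
  case Bot
  then show ?case using consistent derives_iff by (auto simp: consistent_def)
qed (auto simp: Imp_iff All_iff inst_rename_lift)

end

lemma henkin_set_Union:
  assumes "\<And>p. p \<in> T \<Longrightarrow> fv_bound p = 0" and "consistent T"
  shows "henkin_set (\<Union>n. henkin T n)"
proof
  show con: "consistent (\<Union>n. henkin T n)"
    unfolding consistent_def
  proof
    assume "(\<Union>n. henkin T n) \<turnstile> Bot"
    then obtain G where G: "finite G" "G \<subseteq> (\<Union>n. henkin T n)" "G \<turnstile> Bot"
      using derives_finite by blast
    \<comment> \<open>The stages form a chain, so a finite set of formulas is contained in one of
      them.\<close>
    from G(1,2) have "\<exists>n. G \<subseteq> henkin T n"
    proof (induction G)
      case (insert p G)
      then obtain m n where "G \<subseteq> henkin T n" "p \<in> henkin T m" by auto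
      then have "insert p G \<subseteq> henkin T (max m n)"
        using henkin_mono[of m "max m n" T] henkin_mono[of n "max m n" T] by auto
      then show ?case by blast
    qed simp
    then show False
      using G(3) derives_mono henkin_consistent[OF assms] unfolding consistent_def by blast
  qed
  fix p
  assume *: "consistent (insert p (\<Union>n. henkin T n))"
  \<comment> \<open>Formula \<open>p\<close> is tested at stage \<open>to_nat p\<close>, and
    consistency with the whole limit implies consistency with that stage.\<close>
  have "consistent (insert p (henkin T (to_nat p)))"
    using * derives_mono[OF _ insert_mono] unfolding consistent_def by (metis UN_upper UNIV_I)
  then have "p \<in> henkin T (Suc (to_nat p))" by (simp add: Let_def)
  then show "p \<in> (\<Union>n. henkin T n)" by blast
next
  fix q
  assume *: "Neg (All q) \<in> (\<Union>n. henkin T n)"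
  \<comment> \<open>The witness enters when the formula itself is tested, even if the formula was
    present earlier. A common later stage shows that this test succeeds.\<close>
  let ?n = "to_nat (Neg (All q))"
  have "consistent (insert (Neg (All q)) (henkin T ?n))"
  proof -
    obtain m where "Neg (All q) \<in> henkin T m" using * by blast
    then have "insert (Neg (All q)) (henkin T ?n) \<subseteq> henkin T (max m ?n)"
      using henkin_mono[of m "max m ?n" T] henkin_mono[of ?n "max m ?n" T] by auto
    then show ?thesis
      using henkin_consistent[OF assms] derives_mono unfolding consistent_def by blast
  qed
  then have "\<exists>c. Neg (inst c q) \<in> henkin T (Suc ?n)" by (auto simp: Let_def)
  then show "\<exists>c. Neg (inst c q) \<in> (\<Union>n. henkin T n)" by blast
qed

text \<open>The countermodel is the term model of a Henkin extension of \<open>T\<close> with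
  \<open>Neg p\<close>. Its universe is the set of variable indices, so validity is only required
  over \<open>nat\<close>, for all interpretations of equality by a congruence.\<close>

theorem completeness:
  fixes T :: "fm set" and p :: fm
  assumes closed: "\<And>q. q \<in> T \<Longrightarrow> fv_bound q = 0" "fv_bound p = 0"
    and valid: "\<And>(E :: nat \<Rightarrow> nat \<Rightarrow> bool) Q. equivp Q \<Longrightarrow>
      (\<And>i i' j j'. Q i i' \<Longrightarrow> Q j j' \<Longrightarrow> E i j \<Longrightarrow> E i' j') \<Longrightarrow>
      (\<And>q e. q \<in> T \<Longrightarrow> sat E Q e q) \<Longrightarrow> (\<And>e. sat E Q e p)"
  shows "T \<turnstile> p"
proof (rule ccontr)
  let ?T = "insert (Neg p) T"
  assume "\<not> T \<turnstile> p"
  then have "consistent ?T" unfolding consistent_def using derives.Classical by blast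
  moreover have cl: "\<And>q. q \<in> ?T \<Longrightarrow> fv_bound q = 0" using closed by auto
  ultimately interpret henkin_set "\<Union>n. henkin ?T n" by (intro henkin_set_Union)
  let ?H = "\<Union>n. henkin ?T n"
  let ?E = "\<lambda>i j. Mem i j \<in> ?H" and ?Q = "\<lambda>i j. Eq i j \<in> ?H"
  have sub: "?T \<subseteq> ?H"
    using henkin.simps(1)[of ?T] by blast
  have *: "sat ?E ?Q e q" if "q \<in> ?T" for e q
  proof -
    have "sat ?E ?Q e q = sat ?E ?Q id q"
      by (rule sat_cong) (use cl[OF that] in simp)
    then show ?thesis using truth[of id q] sub that by (auto simp: rename_id)
  qed
  have "sat ?E ?Q id p"
  proof (rule valid)
    show "equivp ?Q"
      by (intro equivpI reflpI sympI transpI) (fact Eq_refl Eq_sym Eq_trans)+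
    show "?E i' j'" if "?Q i i'" "?Q j j'" "?E i j" for i i' j j'
      using Mem_cong that .
    show "sat ?E ?Q e q" if "q \<in> T" for e q
      by (rule *) (use that in simp)
  qed
  moreover have "sat ?E ?Q id (Neg p)" by (rule *) simp
  ultimately show False by simp
qed


section \<open>Semantics of readable formulas\<close>

text \<open>The variable that \<open>fAll\<close> hands to its body, under a name on which the
  simplifier can match.\<close>

definition bound_var :: "nat \<Rightarrow> var" where
  "bound_var c = (\<lambda>d. d - Suc c)"

text \<open>\<open>in_scope x d\<close>: from depth \<open>d\<close> on, \<open>x\<close> denotes the same variable.\<close>

definition in_scope :: "var \<Rightarrow> nat \<Rightarrow> bool" where
  "in_scope x d \<longleftrightarrow> (\<forall>d'\<ge>d. x (Suc d') = Suc (x d'))"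

lemma in_scope_bound_var [simp]: "c < d \<Longrightarrow> in_scope (bound_var c) d"
  by (auto simp: in_scope_def bound_var_def)

lemma in_scope_Suc [simp]: "in_scope x d \<Longrightarrow> in_scope x (Suc d)"
  by (auto simp: in_scope_def)

lemma case_nat_bound_var [simp]: "case_nat a e (bound_var d (Suc d)) = a"
  by (simp add: bound_var_def)

lemma case_nat_in_scope [simp]: "in_scope x d \<Longrightarrow> case_nat a e (x (Suc d)) = e (x d)"
  by (simp add: in_scope_def)

lemma sat_form [simp]:
  "sat E Q e ((x \<^bold>\<in> y) d) \<longleftrightarrow> E (e (x d)) (e (y d))"
  "sat E Q e ((x \<^bold>= y) d) \<longleftrightarrow> Q (e (x d)) (e (y d))"
  "sat E Q e ((P \<^bold>\<longrightarrow> R) d) \<longleftrightarrow> (sat E Q e (P d) \<longrightarrow> sat E Q e (R d))"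
  "sat E Q e ((\<^bold>\<not> P) d) \<longleftrightarrow> \<not> sat E Q e (P d)"
  "sat E Q e ((P \<^bold>\<and> R) d) \<longleftrightarrow> sat E Q e (P d) \<and> sat E Q e (R d)"
  "sat E Q e ((P \<^bold>\<or> R) d) \<longleftrightarrow> sat E Q e (P d) \<or> sat E Q e (R d)"
  "sat E Q e ((P \<^bold>\<longleftrightarrow> R) d) \<longleftrightarrow> (sat E Q e (P d) \<longleftrightarrow> sat E Q e (R d))"
  by (auto simp: fMem_def fEq_def fImp_def fNot_def fAnd_def fOr_def fIff_def)

lemma sat_quantifier [simp]:
  "sat E Q e (fAll F d) \<longleftrightarrow> (\<forall>a. sat E Q (case_nat a e) (F (bound_var d) (Suc d)))"
  "sat E Q e (fEx F d) \<longleftrightarrow> (\<exists>a. sat E Q (case_nat a e) (F (bound_var d) (Suc d)))"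
  by (simp_all add: fAll_def fEx_def bound_var_def fNot_def)

lemma sat_univ_closure:
  assumes "\<And>e. sat E Q e (univ_closure p)"
  shows "sat E Q e p"
proof -
  \<comment> \<open>Generalised to any number \<open>n\<close> of quantifiers: the assignment
    shifted by \<open>n\<close> leaves \<open>e (n - 1)\<close> down to \<open>e 0\<close> to be
    supplied, from the outermost quantifier inwards.\<close>
  have "sat E Q (\<lambda>k. e (k + n)) ((All ^^ n) p) \<Longrightarrow> sat E Q e p" for n
  proof (induction n)
    case (Suc n)
    have "case_nat (e n) (\<lambda>k. e (k + Suc n)) = (\<lambda>k. e (k + n))"
      by (auto simp: fun_eq_iff split: nat.split)
    then have "sat E Q (\<lambda>k. e (k + n)) ((All ^^ n) p)"
      using Suc.prems by (auto dest: spec[of _ "e n"])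
    then show ?case by (rule Suc.IH)
  qed simp
  then show ?thesis using assms unfolding univ_closure_def by blast
qed

lemma ZF_closed: "q \<in> ZF \<Longrightarrow> fv_bound q = 0"
proof -
  have "fv_bound ((All ^^ n) p) = fv_bound p - n" for n p
    by (induction n) auto
  then have *: "fv_bound (univ_closure p) = 0" for p
    by (simp add: univ_closure_def)
  have "fv_bound (ax_extensionality 0) = 0" "fv_bound (ax_foundation 0) = 0"
    "fv_bound (ax_pairing 0) = 0" "fv_bound (ax_union 0) = 0" "fv_bound (ax_power 0) = 0"
    "fv_bound (ax_infinity 0) = 0"
    by code_simp+
  then show "q \<in> ZF \<Longrightarrow> fv_bound q = 0" by (auto simp: ZF_def *)
qed

lemma sat_app [simp]:
  "sat E Q e (app1 \<phi> x d) \<longleftrightarrow> sat E Q (case_nat (e (x d)) (\<lambda>k. e (k + d))) \<phi>"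
  "sat E Q e (app2 \<phi> x y d) \<longleftrightarrow>
    sat E Q (case_nat (e (x d)) (case_nat (e (y d)) (\<lambda>k. e (k + d)))) \<phi>"
  unfolding app1_def app2_def sat_rename
  by (rule arg_cong[where f = "\<lambda>e. sat E Q e \<phi>"], simp add: fun_eq_iff split: nat.split)+

text \<open>The kernel of \<open>f\<close> is \<open>Q\<close>, so \<open>f\<close> presents the
  quotient without a quotient type. Atomic formulas are settled because \<open>E\<close> respects
  \<open>Q\<close>, quantifiers because \<open>f\<close> is surjective.\<close>

lemma sat_quotient:
  assumes "surj f" and f: "\<And>i j. f i = f j \<longleftrightarrow> Q i j"
    and E: "\<And>i i' j j'. Q i i' \<Longrightarrow> Q j j' \<Longrightarrow> E i j \<Longrightarrow> E i' j'"
  shows "sat (\<lambda>a b. \<exists>i j. f i = a \<and> f j = b \<and> E i j) (=) (\<lambda>k. f (e k)) p \<longleftrightarrow> sat E Q e p"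
proof (induction p arbitrary: e)
  case (Mem i j)
  then show ?case using E f by auto metis
next
  case (All p)
  have "(\<lambda>k. f (case_nat i e k)) = case_nat (f i) (\<lambda>k. f (e k))" for i
    by (auto simp: fun_eq_iff split: nat.split)
  then have "sat (\<lambda>a b. \<exists>i j. f i = a \<and> f j = b \<and> E i j) (=) (case_nat (f i) (\<lambda>k. f (e k))) p
      \<longleftrightarrow> sat E Q (case_nat i e) p" for i
    using All.IH[of "case_nat i e"] by simp
  moreover have "(\<forall>a. R a) \<longleftrightarrow> (\<forall>i. R (f i))" for R
    using \<open>surj f\<close> by (metis surjD)
  ultimately show ?case by simp
qed (auto simp: f)

text \<open>Otherwise some set would contain a representative of every class, against Russell's paradox.\<close>

lemma ZF_model_infinite:
  assumes Q: "equivp Q" and E: "\<And>i i' j j'. Q i i' \<Longrightarrow> Q j j' \<Longrightarrow> E i j \<Longrightarrow> E i' j'"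
    and ZF: "\<And>q e. q \<in> ZF \<Longrightarrow> sat E Q e q"
  shows "infinite (range (\<lambda>i. {j. Q i j}))"
proof
  assume "finite (range (\<lambda>i. {j. Q i j}))"
  then obtain F where F: "finite F" "range (\<lambda>i. {j. Q i j}) = (\<lambda>i. {j. Q i j}) ` F"
    by (metis finite_subset_image order_refl)
  have refl: "Q i i" for i using Q by (simp add: equivp_reflp)
  have pairing: "\<exists>z. \<forall>w. E w z \<longleftrightarrow> Q w x \<or> Q w y" for x y
    using ZF[of "ax_pairing 0"] by (simp add: ZF_def ax_pairing_def is_upair_def)
  have union: "\<exists>z. \<forall>w. E w z \<longleftrightarrow> (\<exists>y. E y x \<and> E w y)" for x
    using ZF[of "ax_union 0"] by (simp add: ZF_def ax_union_def is_Union_def)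
  have russell: "\<exists>b. \<forall>x. E x b \<longleftrightarrow> E x a \<and> \<not> E x x" for a
  proof -
    have "sat E Q e (ax_separation (Neg (Mem 0 0)) 0)" for e
      by (rule sat_univ_closure, rule ZF) (auto simp: ZF_def)
    then show ?thesis by (simp add: ax_separation_def)
  qed
  \<comment> \<open>Finitely many elements are collected one at a time: \<open>x\<close> is an
    element of \<open>s\<close>, and the union of a set containing \<open>v\<close> and
    \<open>s\<close> has all elements of both.\<close>
  have "\<exists>v. \<forall>x\<in>F. E x v" using F(1)
  proof (induction F)
    case (insert x F)
    then obtain v where v: "\<forall>x\<in>F. E x v" by blast
    obtain s where "E x s" using pairing[of x x] refl by blast
    moreover obtain z where "E v z" "E s z" using pairing[of v s] refl by blast
    ultimately show ?case using union[of z] v by blast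
  qed simp
  then obtain v where v: "\<forall>x\<in>F. E x v" by blast
  have "E x v" for x
  proof -
    obtain y where y: "y \<in> F" "{j. Q x j} = {j. Q y j}" using F(2) by blast
    then have "Q y x" using refl by blast
    then show ?thesis using E v y(1) refl by blast
  qed
  then show False using russell[of v] by blast
qed

locale zf_model =
  fixes E :: "'a \<Rightarrow> 'a \<Rightarrow> bool"  (infix "\<epsilon>" 50)
  assumes ZF: "q \<in> ZF \<Longrightarrow> sat E (=) e q"

text \<open>Numbering the classes of the term model moves the quotient back onto \<open>nat\<close>,
  so models on this one type with true equality suffice.\<close>

theorem ZF_completeness:
  assumes closed: "fv_bound p = 0"
    and valid: "\<And>(E :: nat \<Rightarrow> nat \<Rightarrow> bool) e. zf_model E \<Longrightarrow> sat E (=) e p"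
  shows "ZF \<turnstile> p"
proof (rule completeness[OF ZF_closed closed])
  fix E Q :: "nat \<Rightarrow> nat \<Rightarrow> bool" and e
  assume Q: "equivp Q" and E: "\<And>i i' j j'. Q i i' \<Longrightarrow> Q j j' \<Longrightarrow> E i j \<Longrightarrow> E i' j'"
    and ZF: "\<And>q e. q \<in> ZF \<Longrightarrow> sat E Q e q"
  define cls where "cls i = {j. Q i j}" for i
  define f where "f i = to_nat_on (range cls) (cls i)" for i
  \<comment> \<open>With infinitely many classes the numbering is a bijection onto
    \<open>nat\<close>, so no number is left without a class.\<close>
  have "infinite (range cls)"
    unfolding cls_def by (rule ZF_model_infinite[OF Q E ZF])
  then have bij: "bij_betw (to_nat_on (range cls)) (range cls) UNIV"
    by (simp add: to_nat_on_infinite)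
  have "surj f"
    using bij_betw_imp_surj_on[OF bij] unfolding f_def by (simp add: image_image[symmetric])
  have f: "f i = f j \<longleftrightarrow> Q i j" for i j
  proof -
    have "f i = f j \<longleftrightarrow> cls i = cls j"
      unfolding f_def using bij_betw_imp_inj_on[OF bij] by (simp add: inj_on_eq_iff)
    then show ?thesis using Q unfolding cls_def equivp_def by auto
  qed
  let ?E = "\<lambda>a b. \<exists>i j. f i = a \<and> f j = b \<and> E i j"
  have quotient: "sat ?E (=) (\<lambda>k. f (e k)) q \<longleftrightarrow> sat E Q e q" for e q
    using \<open>surj f\<close> f E by (rule sat_quotient)
  have "zf_model ?E"
  proof
    fix q e
    assume "q \<in> ZF"
    then have "sat E Q (\<lambda>k. inv f (e k)) q" by (rule ZF)
    then have "sat ?E (=) (\<lambda>k. f (inv f (e k))) q"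
      by (rule quotient[THEN iffD2])
    then show "sat ?E (=) e q" using \<open>surj f\<close> by (simp add: surj_f_inv_f)
  qed
  then show "sat E Q e p" by (intro quotient[THEN iffD1] valid)
qed


section \<open>Definability with parameters\<close>

context zf_model
begin

abbreviation sats :: "(nat \<Rightarrow> 'a) \<Rightarrow> fm \<Rightarrow> bool" where
  "sats \<equiv> sat E (=)"

text \<open>The assignment \<open>r\<close> makes each free index of \<open>\<phi>\<close> an argument (\<open>Inl\<close>) or a parameter (\<open>Inr\<close>).\<close>

definition definable :: "((nat \<Rightarrow> 'a) \<Rightarrow> bool) \<Rightarrow> bool" where
  "definable P \<longleftrightarrow> (\<exists>\<phi> r. \<forall>e. P e \<longleftrightarrow> sats (\<lambda>k. case_sum e id (r k)) \<phi>)"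

text \<open>In the graph of \<open>F\<close>, index 0 is the value and the arguments are shifted up.\<close>

definition definable_term :: "((nat \<Rightarrow> 'a) \<Rightarrow> 'a) \<Rightarrow> bool" where
  "definable_term F \<longleftrightarrow> definable (\<lambda>e. e 0 = F (\<lambda>k. e (Suc k)))"

lemma definableI: "(\<And>e. P e \<longleftrightarrow> sats (\<lambda>k. case_sum e id (r k)) \<phi>) \<Longrightarrow> definable P"
  unfolding definable_def by blast

named_theorems definable_intros

lemma definable_const [definable_intros]: "definable (\<lambda>e. Q)"
  by (rule definableI[of _ _ "if Q then Imp Bot Bot else Bot"]) auto

lemma definable_imp [definable_intros]:
  assumes "definable P" "definable Q"
  shows "definable (\<lambda>e. P e \<longrightarrow> Q e)"
proof -
  obtain \<phi> r \<psi> s where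
    "\<And>e. P e \<longleftrightarrow> sats (\<lambda>k. case_sum e id (r k)) \<phi>"
    "\<And>e. Q e \<longleftrightarrow> sats (\<lambda>k. case_sum e id (s k)) \<psi>"
    using assms unfolding definable_def by blast
  \<comment> \<open>Even indices carry the variables of the first formula and odd indices those of
    the second, so the two assignments cannot collide.\<close>
  then show ?thesis
    by (intro definableI[of _ "\<lambda>k. if even k then r (k div 2) else s (k div 2)"
          "Imp (rename (\<lambda>k. 2 * k) \<phi>) (rename (\<lambda>k. 2 * k + 1) \<psi>)"])
      (simp add: sat_rename)
qed

lemma definable_all [definable_intros]:
  assumes "definable (\<lambda>e. P (e 0) (\<lambda>k. e (Suc k)))"
  shows "definable (\<lambda>e. \<forall>x. P x e)"
proof -
  obtain \<phi> r where *: "\<And>e. P (e 0) (\<lambda>k. e (Suc k)) \<longleftrightarrow> sats (\<lambda>k. case_sum e id (r k)) \<phi>"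
    using assms unfolding definable_def by blast
  \<comment> \<open>Several indices of the formula may stand for argument 0; all of them are merged
    into the bound index 0, and the others move up by one. In \<open>?r\<close> the remaining
    arguments drop by one.\<close>
  let ?g = "\<lambda>k. if r k = Inl 0 then 0 else Suc k"
  let ?r = "\<lambda>k. case r k of Inl i \<Rightarrow> Inl (i - 1) | Inr a \<Rightarrow> Inr a"
  have "P x e \<longleftrightarrow> sats (case_nat x (\<lambda>k. case_sum e id (?r k))) (rename ?g \<phi>)" for x e
  proof -
    have "case_sum (case_nat x e) id (r k) = case_nat x (\<lambda>k. case_sum e id (?r k)) (?g k)" for k
      by (auto split: sum.split nat.split)
    then show ?thesis using *[of "case_nat x e"] by (simp add: sat_rename)
  qed
  then show ?thesis
    by (intro definableI[of _ ?r "All (rename ?g \<phi>)"]) simp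
qed

lemma definable_not [definable_intros]: "definable P \<Longrightarrow> definable (\<lambda>e. \<not> P e)"
  using definable_imp[OF _ definable_const[of False], of P] by simp

lemma definable_and [definable_intros]:
  "definable P \<Longrightarrow> definable Q \<Longrightarrow> definable (\<lambda>e. P e \<and> Q e)"
  using definable_not[OF definable_imp[OF _ definable_not, of P Q]] by simp

lemma definable_or [definable_intros]:
  "definable P \<Longrightarrow> definable Q \<Longrightarrow> definable (\<lambda>e. P e \<or> Q e)"
  using definable_imp[OF definable_not, of P Q] by (simp add: disj_imp)

lemma definable_iff [definable_intros]:
  "definable P \<Longrightarrow> definable Q \<Longrightarrow> definable (\<lambda>e. P e \<longleftrightarrow> Q e)"
  unfolding iff_conv_conj_imp by (intro definable_intros)

lemma definable_ex [definable_intros]: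
  "definable (\<lambda>e. P (e 0) (\<lambda>k. e (Suc k))) \<Longrightarrow> definable (\<lambda>e. \<exists>x. P x e)"
  using definable_not[OF definable_all[of "\<lambda>x e. \<not> P x e", OF definable_not]] by simp

section \<open>Substitution of terms and parameters\<close>

lemma definable_assign:
  assumes "definable P"
  shows "definable (\<lambda>e. P (\<lambda>k. case_sum e id (s k)))"
proof -
  obtain \<phi> r where *: "\<And>e. P e \<longleftrightarrow> sats (\<lambda>k. case_sum e id (r k)) \<phi>"
    using assms unfolding definable_def by blast
  let ?r = "\<lambda>k. case_sum s Inr (r k)"
  have "(\<lambda>k. case_sum e id (?r k)) = (\<lambda>k. case_sum (\<lambda>k. case_sum e id (s k)) id (r k))" for e
    by (auto simp: fun_eq_iff split: sum.split)
  then show ?thesis by (intro definableI[of _ ?r \<phi>]) (simp only: *)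
qed

lemma definable_rename: "definable P \<Longrightarrow> definable (\<lambda>e. P (\<lambda>k. e (s k)))"
  using definable_assign[of P "\<lambda>k. Inl (s k)"] by simp

lemma definable_term_rename: "definable_term F \<Longrightarrow> definable_term (\<lambda>e. F (\<lambda>k. e (s k)))"
  unfolding definable_term_def
  using definable_rename[of "\<lambda>e. e 0 = F (\<lambda>k. e (Suc k))" "case_nat 0 (\<lambda>k. Suc (s k))"]
  by simp

text \<open>The language has no function terms, so a defined value is substituted by quantifying
  over all \<open>x\<close> with \<open>x = F e\<close>.\<close>

lemma definable_subst:
  assumes "definable_term F" and "definable (\<lambda>e. P (e 0) (\<lambda>k. e (Suc k)))"
  shows "definable (\<lambda>e. P (F e) e)"
  using definable_all[of "\<lambda>x e. x = F e \<longrightarrow> P x e", OF definable_imp[OF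
        assms(1)[unfolded definable_term_def] assms(2)]] by simp

lemma definable_subst1:
  assumes "definable (\<lambda>e. P (e 0))" and "definable_term F"
  shows "definable (\<lambda>e. P (F e))"
  by (rule definable_subst[OF assms(2), where P = "\<lambda>x e. P x"]) (rule assms(1))

lemma definable_subst2:
  assumes P: "definable (\<lambda>e. P (e 0) (e (Suc 0)))" and F: "definable_term F" and G: "definable_term G"
  shows "definable (\<lambda>e. P (F e) (G e))"
proof (rule definable_subst[OF F, where P = "\<lambda>x e. P x (G e)"])
  show "definable (\<lambda>e. P (e 0) (G (\<lambda>k. e (Suc k))))"
  proof (rule definable_subst[OF definable_term_rename[OF G], where P = "\<lambda>y e. P (e 0) y"])
    show "definable (\<lambda>e. P (e (Suc 0)) (e 0))"
      using definable_rename[OF P, of "\<lambda>k. if k = 0 then Suc 0 else 0"] by simp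
  qed
qed

lemma definable_subst3:
  assumes P: "definable (\<lambda>e. P (e 0) (e (Suc 0)) (e (Suc (Suc 0))))"
    and F: "definable_term F" and G: "definable_term G" and H: "definable_term H"
  shows "definable (\<lambda>e. P (F e) (G e) (H e))"
proof (rule definable_subst[OF F, where P = "\<lambda>x e. P x (G e) (H e)"])
  show "definable (\<lambda>e. P (e 0) (G (\<lambda>k. e (Suc k))) (H (\<lambda>k. e (Suc k))))"
  proof (rule definable_subst[OF definable_term_rename[OF G],
        where P = "\<lambda>y e. P (e 0) y (H (\<lambda>k. e (Suc k)))"])
    show "definable (\<lambda>e. P (e (Suc 0)) (e 0) (H (\<lambda>k. e (Suc (Suc k)))))"
    proof (rule definable_subst[OF definable_term_rename[OF H, of "\<lambda>k. Suc (Suc k)"],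
          where P = "\<lambda>z e. P (e (Suc 0)) (e 0) z"])
      \<comment> \<open>Each substitution puts its new variable in front, so the three arguments
        arrive in reverse order, which \<open>2 - k\<close> corrects.\<close>
      show "definable (\<lambda>e. P (e (Suc (Suc 0))) (e (Suc 0)) (e 0))"
        using definable_rename[OF P, of "\<lambda>k. 2 - k"] by (simp add: eval_nat_numeral)
    qed
  qed
qed

text \<open>Freezes an outer assignment as parameters: a comprehension nested inside other binders
  needs its schema instance for one fixed \<open>e\<close>.\<close>

lemma definable_param1:
  assumes "definable (\<lambda>e. P (e 0) (\<lambda>k. e (Suc k)))"
  shows "definable (\<lambda>e'. P (e' 0) e)"
  using definable_assign[OF assms, of "case_nat (Inl 0) (\<lambda>k. Inr (e k))"] by simp

lemma definable_param2:
  assumes "definable (\<lambda>e. P (e 0) (e (Suc 0)) (\<lambda>k. e (Suc (Suc k))))"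
  shows "definable (\<lambda>e'. P (e' 0) (e' (Suc 0)) e)"
  using definable_assign[OF assms, of "case_nat (Inl 0) (case_nat (Inl 1) (\<lambda>k. Inr (e k)))"] by simp

lemma definable_term_var [definable_intros]: "definable_term (\<lambda>e. e i)"
  unfolding definable_term_def
  by (rule definableI[of _ "\<lambda>k. if k = 0 then Inl 0 else Inl (Suc i)" "Eq 0 1"]) simp

lemma definable_term_const [definable_intros]: "definable_term (\<lambda>e. c)"
  unfolding definable_term_def
  by (rule definableI[of _ "\<lambda>k. if k = 0 then Inl 0 else Inr c" "Eq 0 1"]) simp

lemma definable_eq [definable_intros]:
  assumes "definable_term F" "definable_term G"
  shows "definable (\<lambda>e. F e = G e)"
  by (rule definable_subst2[OF _ assms],
      rule definableI[of _ Inl "Eq 0 (Suc 0)"]) simp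

lemma definable_mem [definable_intros]:
  assumes "definable_term F" "definable_term G"
  shows "definable (\<lambda>e. F e \<epsilon> G e)"
  by (rule definable_subst2[OF _ assms, where P = E],
      rule definableI[of _ Inl "Mem 0 (Suc 0)"]) simp

lemma definable_term1:
  assumes "definable (\<lambda>e. e 0 = f (e (Suc 0)))" "definable_term F"
  shows "definable_term (\<lambda>e. f (F e))"
  unfolding definable_term_def
  by (rule definable_subst2[OF _ definable_term_var definable_term_rename[OF assms(2)],
        where P = "\<lambda>y x. y = f x"]) (rule assms(1))

lemma definable_term2:
  assumes "definable (\<lambda>e. e 0 = f (e (Suc 0)) (e (Suc (Suc 0))))" "definable_term F" "definable_term G"
  shows "definable_term (\<lambda>e. f (F e) (G e))"
  unfolding definable_term_def
  by (rule definable_subst3[OF _ definable_term_var definable_term_rename[OF assms(2)]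
        definable_term_rename[OF assms(3)], where P = "\<lambda>y x. \<lambda>z. y = f x z"]) (rule assms(1))

lemma definable_params:
  assumes "definable P"
  shows "\<exists>\<phi> s. \<forall>x y. P (case_nat x (case_nat y (\<lambda>_. undefined))) \<longleftrightarrow> sats (case_nat x (case_nat y s)) \<phi>"
proof -
  obtain \<phi> r where *: "\<And>e. P e \<longleftrightarrow> sats (\<lambda>k. case_sum e id (r k)) \<phi>"
    using assms unfolding definable_def by blast
  \<comment> \<open>The schemas want their arguments at indices 0 and 1. All other indices move up
    by two and become parameters; those standing for further arguments receive
    \<open>undefined\<close>, as on the left-hand side.\<close>
  let ?g = "\<lambda>k. if r k = Inl 0 then 0 else if r k = Inl 1 then 1 else Suc (Suc k)"
  let ?s = "\<lambda>k. case r k of Inl i \<Rightarrow> undefined | Inr a \<Rightarrow> a"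
  have "case_nat x (case_nat y ?s) (?g k) = case_sum (case_nat x (case_nat y (\<lambda>_. undefined))) id (r k)"
    for x y k
    by (auto split: sum.split nat.split)
  then show ?thesis
    by (intro exI[of _ "rename ?g \<phi>"] exI[of _ ?s]) (simp add: * sat_rename)
qed

section \<open>The axiom schemas for definable predicates and functions\<close>

lemma separation:
  assumes "definable (\<lambda>e. P (e 0))"
  shows "\<exists>b. \<forall>x. x \<epsilon> b \<longleftrightarrow> x \<epsilon> a \<and> P x"
proof -
  obtain \<phi> s where *: "\<And>x y. P x \<longleftrightarrow> sats (case_nat x (case_nat y s)) \<phi>"
    using definable_params[OF assms] by auto
  \<comment> \<open>Only one argument is wanted here, so the second slot of \<open>\<phi>\<close> is
    filled by an arbitrary parameter.\<close>
  have "sats (case_nat undefined s) (ax_separation \<phi> 0)"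
    by (rule sat_univ_closure, rule ZF) (auto simp: ZF_def)
  then show ?thesis using *[of _ undefined] by (simp add: ax_separation_def numeral_eq_Suc)
qed

lemma replacement:
  assumes "definable (\<lambda>e. e 0 = f (e (Suc 0)))"
  shows "\<exists>b. \<forall>y. y \<epsilon> b \<longleftrightarrow> (\<exists>x. x \<epsilon> a \<and> y = f x)"
proof -
  \<comment> \<open>The schema puts the argument before the value, a graph in the sense of
    \<open>definable_term\<close> the value first, so the two are exchanged.\<close>
  have "definable (\<lambda>e. e (Suc 0) = f (e 0))"
    by (intro definable_intros definable_term1[OF assms])
  then obtain \<phi> s where *: "\<And>x y. y = f x \<longleftrightarrow> sats (case_nat x (case_nat y s)) \<phi>"
    using definable_params[of "\<lambda>e. e (Suc 0) = f (e 0)"] by auto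
  have "sats s (ax_replacement \<phi> 0)"
    by (rule sat_univ_closure, rule ZF) (auto simp: ZF_def)
  then show ?thesis
    by (simp add: ax_replacement_def numeral_eq_Suc *[symmetric])
qed


section \<open>Set theory inside a model\<close>

lemma extensionality: "(\<And>z. z \<epsilon> x \<longleftrightarrow> z \<epsilon> y) \<Longrightarrow> x = y"
  using ZF[of "ax_extensionality 0"] by (simp add: ZF_def ax_extensionality_def)

lemma foundation: "z \<epsilon> x \<Longrightarrow> \<exists>y. y \<epsilon> x \<and> \<not> (\<exists>z. z \<epsilon> x \<and> z \<epsilon> y)"
  using ZF[of "ax_foundation 0"] by (auto simp: ZF_def ax_foundation_def is_nonempty_def)

section \<open>Set operations as definable terms\<close>

definition sub :: "'a \<Rightarrow> 'a \<Rightarrow> bool" where "sub x y \<longleftrightarrow> (\<forall>z. z \<epsilon> x \<longrightarrow> z \<epsilon> y)"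
definition emp :: 'a where "emp = (THE x. \<forall>z. \<not> z \<epsilon> x)"
definition upair :: "'a \<Rightarrow> 'a \<Rightarrow> 'a" where "upair x y = (THE z. \<forall>w. w \<epsilon> z \<longleftrightarrow> w = x \<or> w = y)"
definition BigUn :: "'a \<Rightarrow> 'a" where "BigUn x = (THE z. \<forall>w. w \<epsilon> z \<longleftrightarrow> (\<exists>y. y \<epsilon> x \<and> w \<epsilon> y))"
definition Pw :: "'a \<Rightarrow> 'a" where "Pw x = (THE z. \<forall>w. w \<epsilon> z \<longleftrightarrow> sub w x)"
text \<open>\<open>Sep\<close> and \<open>Img\<close> are unspecified unless \<open>P\<close> and \<open>f\<close> are definable.\<close>

definition Sep :: "'a \<Rightarrow> ('a \<Rightarrow> bool) \<Rightarrow> 'a" where "Sep a P = (THE z. \<forall>w. w \<epsilon> z \<longleftrightarrow> w \<epsilon> a \<and> P w)"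
definition Img :: "'a \<Rightarrow> ('a \<Rightarrow> 'a) \<Rightarrow> 'a" where "Img a f = (THE z. \<forall>w. w \<epsilon> z \<longleftrightarrow> (\<exists>x. x \<epsilon> a \<and> w = f x))"

lemma the_set: "\<exists>z. \<forall>w. w \<epsilon> z \<longleftrightarrow> P w \<Longrightarrow> w \<epsilon> (THE z. \<forall>w. w \<epsilon> z \<longleftrightarrow> P w) \<longleftrightarrow> P w"
proof (elim exE)
  fix z assume z: "\<forall>w. w \<epsilon> z \<longleftrightarrow> P w"
  then have "(THE z. \<forall>w. w \<epsilon> z \<longleftrightarrow> P w) = z"
    by (intro the_equality extensionality) simp_all
  with z show ?thesis by simp
qed

lemma mem_Sep: "definable (\<lambda>e. P (e 0)) \<Longrightarrow> w \<epsilon> Sep a P \<longleftrightarrow> w \<epsilon> a \<and> P w"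
  unfolding Sep_def by (intro the_set separation)

lemma mem_Img: "definable (\<lambda>e. e 0 = f (e (Suc 0))) \<Longrightarrow> w \<epsilon> Img a f \<longleftrightarrow> (\<exists>x. x \<epsilon> a \<and> w = f x)"
  unfolding Img_def by (intro the_set replacement)

lemma mem_emp [simp]: "\<not> z \<epsilon> emp"
proof -
  have "\<exists>z. \<forall>w. w \<epsilon> z \<longleftrightarrow> False"
    using separation[of "\<lambda>_. False" undefined] definable_const by simp
  from the_set[OF this] show ?thesis by (simp add: emp_def)
qed

lemma mem_upair [simp]: "w \<epsilon> upair x y \<longleftrightarrow> w = x \<or> w = y"
  unfolding upair_def
  by (rule the_set) (use ZF[of "ax_pairing 0"] in \<open>simp add: ZF_def ax_pairing_def is_upair_def\<close>)

lemma mem_BigUn [simp]: "w \<epsilon> BigUn x \<longleftrightarrow> (\<exists>y. y \<epsilon> x \<and> w \<epsilon> y)"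
  unfolding BigUn_def
  by (rule the_set) (use ZF[of "ax_union 0"] in \<open>simp add: ZF_def ax_union_def is_Union_def\<close>)

lemma mem_Pw [simp]: "w \<epsilon> Pw x \<longleftrightarrow> sub w x"
  unfolding Pw_def sub_def
  by (rule the_set) (use ZF[of "ax_power 0"] in \<open>simp add: ZF_def ax_power_def is_subset_def\<close>)

lemma eq_emp: "x = emp \<longleftrightarrow> (\<forall>z. \<not> z \<epsilon> x)"
  using extensionality[of x emp] by auto

lemma sub_refl [simp]: "sub x x"
  by (simp add: sub_def)

lemma eq_upair: "z = upair x y \<longleftrightarrow> (\<forall>w. w \<epsilon> z \<longleftrightarrow> w = x \<or> w = y)"
  using extensionality[of z "upair x y"] by auto

lemma definable_sub [definable_intros]:
  "definable_term F \<Longrightarrow> definable_term G \<Longrightarrow> definable (\<lambda>e. sub (F e) (G e))"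
  by (rule definable_subst2[where P = sub]) (unfold sub_def, intro definable_intros)

lemma definable_term_upair [definable_intros]:
  "definable_term F \<Longrightarrow> definable_term G \<Longrightarrow> definable_term (\<lambda>e. upair (F e) (G e))"
  by (rule definable_term2[where f = upair]) (unfold eq_upair, intro definable_intros)

lemma definable_term_BigUn [definable_intros]: "definable_term F \<Longrightarrow> definable_term (\<lambda>e. BigUn (F e))"
proof (rule definable_term1[where f = BigUn])
  have "z = BigUn x \<longleftrightarrow> (\<forall>w. w \<epsilon> z \<longleftrightarrow> (\<exists>y. y \<epsilon> x \<and> w \<epsilon> y))" for x z
    using extensionality[of z "BigUn x"] by auto
  then show "definable (\<lambda>e. e 0 = BigUn (e (Suc 0)))"
    by (simp only:) (intro definable_intros)
qed

lemma definable_term_Pw [definable_intros]: "definable_term F \<Longrightarrow> definable_term (\<lambda>e. Pw (F e))"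
proof (rule definable_term1[where f = Pw])
  have "z = Pw x \<longleftrightarrow> (\<forall>w. w \<epsilon> z \<longleftrightarrow> sub w x)" for x z
    using extensionality[of z "Pw x"] by auto
  then show "definable (\<lambda>e. e 0 = Pw (e (Suc 0)))"
    by (simp only:) (intro definable_intros)
qed

lemma definable_term_Sep [definable_intros]:
  assumes A: "definable_term A" and P: "definable (\<lambda>e. P (e 0) (\<lambda>k. e (Suc k)))"
  shows "definable_term (\<lambda>e. Sep (A e) (\<lambda>x. P x e))"
proof -
  have "z = Sep a (\<lambda>x. P x e) \<longleftrightarrow> (\<forall>w. w \<epsilon> z \<longleftrightarrow> w \<epsilon> a \<and> P w e)" for a e z
    using extensionality[of z "Sep a (\<lambda>x. P x e)"] mem_Sep[of "\<lambda>x. P x e", OF definable_param1[OF P]]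
    by auto
  \<comment> \<open>In the graph formula index 0 is the element \<open>w\<close> and index 1 the
    value \<open>z\<close>, so the original arguments start at index 2.\<close>
  moreover have "definable (\<lambda>e. P (e 0) (\<lambda>k. e (Suc (Suc k))))"
    using definable_rename[OF P, of "case_nat 0 (\<lambda>k. Suc (Suc k))"] by simp
  ultimately show ?thesis unfolding definable_term_def
    by (simp only:) (intro definable_intros definable_term_rename[OF A])
qed

lemma definable_term_Img [definable_intros]:
  assumes A: "definable_term A" and F: "definable_term (\<lambda>e. F (e 0) (\<lambda>k. e (Suc k)))"
  shows "definable_term (\<lambda>e. Img (A e) (\<lambda>x. F x e))"
proof -
  have "definable (\<lambda>e'. e' 0 = F (e' (Suc 0)) e)" for e
    by (rule definable_param2) (rule F[unfolded definable_term_def])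
  then have "z = Img a (\<lambda>x. F x e) \<longleftrightarrow> (\<forall>w. w \<epsilon> z \<longleftrightarrow> (\<exists>x. x \<epsilon> a \<and> w = F x e))" for a e z
    using extensionality[of z "Img a (\<lambda>x. F x e)"] mem_Img[of "\<lambda>x. F x e"]
    by auto
  \<comment> \<open>Here \<open>x\<close>, \<open>w\<close> and the value \<open>z\<close> all
    precede the arguments, hence three shifts.\<close>
  moreover have "definable_term (\<lambda>e. F (e 0) (\<lambda>k. e (Suc (Suc (Suc k)))))"
    using definable_term_rename[OF F, of "case_nat 0 (\<lambda>k. Suc (Suc (Suc k)))"] by simp
  ultimately show ?thesis unfolding definable_term_def[of "\<lambda>e. Img (A e) (\<lambda>x. F x e)"]
    by (simp only:) (intro definable_intros definable_term_rename[OF A])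
qed

definition cup :: "'a \<Rightarrow> 'a \<Rightarrow> 'a" where "cup x y = BigUn (upair x y)"
definition cons :: "'a \<Rightarrow> 'a \<Rightarrow> 'a" where "cons y x = cup x (upair y y)"
definition sdiff :: "'a \<Rightarrow> 'a \<Rightarrow> 'a" where "sdiff x y = Sep x (\<lambda>z. \<not> z \<epsilon> y)"
definition cap :: "'a \<Rightarrow> 'a \<Rightarrow> 'a" where "cap x y = Sep x (\<lambda>z. z \<epsilon> y)"
definition pair :: "'a \<Rightarrow> 'a \<Rightarrow> 'a" where "pair x y = upair (upair x x) (upair x y)"
definition cross :: "'a \<Rightarrow> 'a \<Rightarrow> 'a" where
  "cross a b = Sep (Pw (Pw (cup a b))) (\<lambda>q. \<exists>x y. x \<epsilon> a \<and> y \<epsilon> b \<and> q = pair x y)"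

lemma mem_cup [simp]: "w \<epsilon> cup x y \<longleftrightarrow> w \<epsilon> x \<or> w \<epsilon> y"
  by (auto simp: cup_def)

lemma mem_cons [simp]: "w \<epsilon> cons y x \<longleftrightarrow> w = y \<or> w \<epsilon> x"
  by (auto simp: cons_def)

lemma mem_sdiff [simp]: "w \<epsilon> sdiff x y \<longleftrightarrow> w \<epsilon> x \<and> \<not> w \<epsilon> y"
  unfolding sdiff_def by (intro mem_Sep definable_intros)

lemma mem_cap [simp]: "w \<epsilon> cap x y \<longleftrightarrow> w \<epsilon> x \<and> w \<epsilon> y"
  unfolding cap_def by (intro mem_Sep definable_intros)

lemma upair_inject: "upair x y = upair u v \<longleftrightarrow> x = u \<and> y = v \<or> x = v \<and> y = u"
proof
  assume "upair x y = upair u v"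
  then have "\<And>w. w = x \<or> w = y \<longleftrightarrow> w = u \<or> w = v" by (metis mem_upair)
  then show "x = u \<and> y = v \<or> x = v \<and> y = u" by metis
next
  assume "x = u \<and> y = v \<or> x = v \<and> y = u"
  then show "upair x y = upair u v" by (intro extensionality) auto
qed

lemma pair_inject [simp]: "pair x y = pair u v \<longleftrightarrow> x = u \<and> y = v"
  by (auto simp: pair_def upair_inject)

lemma definable_term_cup [definable_intros]:
  "definable_term F \<Longrightarrow> definable_term G \<Longrightarrow> definable_term (\<lambda>e. cup (F e) (G e))"
  unfolding cup_def by (intro definable_intros)

lemma definable_term_cons [definable_intros]:
  "definable_term F \<Longrightarrow> definable_term G \<Longrightarrow> definable_term (\<lambda>e. cons (F e) (G e))"
  unfolding cons_def by (intro definable_intros)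

lemma definable_term_pair [definable_intros]:
  "definable_term F \<Longrightarrow> definable_term G \<Longrightarrow> definable_term (\<lambda>e. pair (F e) (G e))"
  unfolding pair_def by (intro definable_intros)

lemma definable_term_sdiff [definable_intros]:
  "definable_term F \<Longrightarrow> definable_term G \<Longrightarrow> definable_term (\<lambda>e. sdiff (F e) (G e))"
  by (rule definable_term2[where f = sdiff]) (unfold sdiff_def, intro definable_intros)

lemma mem_cross [simp]: "q \<epsilon> cross a b \<longleftrightarrow> (\<exists>x y. x \<epsilon> a \<and> y \<epsilon> b \<and> q = pair x y)"
proof -
  have "q \<epsilon> cross a b \<longleftrightarrow> q \<epsilon> Pw (Pw (cup a b)) \<and> (\<exists>x y. x \<epsilon> a \<and> y \<epsilon> b \<and> q = pair x y)"
    unfolding cross_def by (intro mem_Sep definable_intros)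
  then show ?thesis by (auto simp: pair_def sub_def)
qed

lemma definable_term_cross [definable_intros]:
  "definable_term F \<Longrightarrow> definable_term G \<Longrightarrow> definable_term (\<lambda>e. cross (F e) (G e))"
  by (rule definable_term2[where f = cross])
    (unfold cross_def, intro definable_intros)


section \<open>Functions, natural numbers and finite sets\<close>

abbreviation definable_fun :: "('a \<Rightarrow> 'a) \<Rightarrow> bool" where
  "definable_fun f \<equiv> definable_term (\<lambda>e. f (e 0))"

abbreviation definable_fun2 :: "('a \<Rightarrow> 'a \<Rightarrow> 'a) \<Rightarrow> bool" where
  "definable_fun2 f \<equiv> definable_term (\<lambda>e. f (e 0) (e (Suc 0)))"

lemma definable_fun_comp: "definable_fun f \<Longrightarrow> definable_term F \<Longrightarrow> definable_term (\<lambda>e. f (F e))"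
  by (rule definable_term1) (simp_all add: definable_term_def)

lemma definable_fun2_comp:
  "definable_fun2 f \<Longrightarrow> definable_term F \<Longrightarrow> definable_term G \<Longrightarrow> definable_term (\<lambda>e. f (F e) (G e))"
  by (rule definable_term2) (simp_all add: definable_term_def)

lemma mem_Img_fun: "definable_fun f \<Longrightarrow> w \<epsilon> Img a f \<longleftrightarrow> (\<exists>x. x \<epsilon> a \<and> w = f x)"
  by (rule mem_Img) (simp add: definable_term_def)

lemma definable_term_if [definable_intros]:
  assumes "definable P" "definable_term F" "definable_term G"
  shows "definable_term (\<lambda>e. if P e then F e else G e)"
proof -
  have "(e 0 = (if P (\<lambda>k. e (Suc k)) then F (\<lambda>k. e (Suc k)) else G (\<lambda>k. e (Suc k)))) \<longleftrightarrow>
    (P (\<lambda>k. e (Suc k)) \<longrightarrow> e 0 = F (\<lambda>k. e (Suc k))) \<and>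
    (\<not> P (\<lambda>k. e (Suc k)) \<longrightarrow> e 0 = G (\<lambda>k. e (Suc k)))" for e :: "nat \<Rightarrow> 'a"
    by auto
  then show ?thesis
    using assms(2,3) unfolding definable_term_def
    by (simp only:) (intro definable_and definable_imp definable_not definable_rename[OF assms(1)])
qed

section \<open>Functions as sets of pairs\<close>

definition is_fun :: "'a \<Rightarrow> 'a \<Rightarrow> bool" where
  "is_fun f a \<longleftrightarrow> (\<forall>p. p \<epsilon> f \<longrightarrow> (\<exists>x y. x \<epsilon> a \<and> p = pair x y)) \<and>
    (\<forall>x. x \<epsilon> a \<longrightarrow> (\<exists>!y. pair x y \<epsilon> f))"

definition lam :: "'a \<Rightarrow> ('a \<Rightarrow> 'a) \<Rightarrow> 'a" where
  "lam a f = Img a (\<lambda>x. pair x (f x))"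

text \<open>For a function the values at \<open>x\<close> form a singleton, and the union of a
  singleton is its element; with Kuratowski pairs every value lies in the double union of
  \<open>g\<close>. Being an explicit term, \<open>app\<close> is definable by the closure
  rules.\<close>

definition app :: "'a \<Rightarrow> 'a \<Rightarrow> 'a" where
  "app g x = BigUn (Sep (BigUn (BigUn g)) (\<lambda>y. pair x y \<epsilon> g))"

lemma definable_is_fun [definable_intros]:
  "definable_term F \<Longrightarrow> definable_term G \<Longrightarrow> definable (\<lambda>e. is_fun (F e) (G e))"
  by (rule definable_subst2[where P = is_fun]) (unfold is_fun_def Ex1_def, intro definable_intros)

lemma definable_term_app [definable_intros]:
  "definable_term F \<Longrightarrow> definable_term G \<Longrightarrow> definable_term (\<lambda>e. app (F e) (G e))"
  by (rule definable_term2[where f = app]) (unfold app_def, intro definable_intros)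

lemma mem_lam: "definable_fun f \<Longrightarrow> p \<epsilon> lam a f \<longleftrightarrow> (\<exists>x. x \<epsilon> a \<and> p = pair x (f x))"
  unfolding lam_def by (rule mem_Img_fun) (intro definable_intros)

lemma pair_mem_lam: "definable_fun f \<Longrightarrow> pair x y \<epsilon> lam a f \<longleftrightarrow> x \<epsilon> a \<and> y = f x"
  by (auto simp: mem_lam)

lemma is_fun_lam: "definable_fun f \<Longrightarrow> is_fun (lam a f) a"
  by (auto simp: is_fun_def mem_lam)

lemma app_eq: 
  assumes "is_fun g a" "x \<epsilon> a"
  shows "pair x y \<epsilon> g \<longleftrightarrow> y = app g x"
proof -
  obtain z where z: "pair x z \<epsilon> g" "\<And>y. pair x y \<epsilon> g \<Longrightarrow> y = z"
    using assms unfolding is_fun_def by blast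
  have "z \<epsilon> upair x z" "upair x z \<epsilon> pair x z" by (simp_all add: pair_def)
  then have "z \<epsilon> BigUn (BigUn g)" unfolding mem_BigUn using z(1) by blast
  moreover have "w \<epsilon> Sep (BigUn (BigUn g)) (\<lambda>y. pair x y \<epsilon> g) \<longleftrightarrow>
      w \<epsilon> BigUn (BigUn g) \<and> pair x w \<epsilon> g" for w
    by (rule mem_Sep) (intro definable_intros)
  ultimately have "w \<epsilon> Sep (BigUn (BigUn g)) (\<lambda>y. pair x y \<epsilon> g) \<longleftrightarrow> w = z" for w
    using z by blast
  then have "app g x = z" unfolding app_def by (intro extensionality) simp
  then show ?thesis using z by blast
qed

lemma is_fun_dom: "is_fun g a \<Longrightarrow> pair x y \<epsilon> g \<Longrightarrow> x \<epsilon> a"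
  by (force simp: is_fun_def)

lemma not_mem_self: "\<not> x \<epsilon> x"
  using foundation[of x "upair x x"] by auto

section \<open>The natural numbers of the model\<close>

definition succ :: "'a \<Rightarrow> 'a" where "succ x = cons x x"

definition ind :: "'a \<Rightarrow> bool" where
  "ind w \<longleftrightarrow> emp \<epsilon> w \<and> (\<forall>x. x \<epsilon> w \<longrightarrow> succ x \<epsilon> w)"

definition omega :: 'a where
  "omega = (THE w. ind w \<and> (\<forall>v. ind v \<longrightarrow> sub w v))"

lemma mem_succ [simp]: "w \<epsilon> succ x \<longleftrightarrow> w = x \<or> w \<epsilon> x"
  by (simp add: succ_def)

lemma definable_term_succ [definable_intros]: "definable_term F \<Longrightarrow> definable_term (\<lambda>e. succ (F e))"
  unfolding succ_def by (intro definable_intros)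

lemma definable_ind [definable_intros]: "definable_term F \<Longrightarrow> definable (\<lambda>e. ind (F e))"
  by (rule definable_subst1[where P = ind]) (unfold ind_def, intro definable_intros)

lemma eq_succ: "z = succ x \<longleftrightarrow> (\<forall>w. w \<epsilon> z \<longleftrightarrow> w \<epsilon> x \<or> w = x)"
  using extensionality[of z "succ x"] by auto

text \<open>Infinity yields one inductive set \<open>u\<close>; those of its elements that belong to
  every inductive set form the least one.\<close>

lemma omega_iff: "w = omega \<longleftrightarrow> ind w \<and> (\<forall>v. ind v \<longrightarrow> sub w v)"
proof -
  have "\<exists>u. (\<exists>y. (\<forall>z. \<not> z \<epsilon> y) \<and> y \<epsilon> u) \<and>
      (\<forall>x. x \<epsilon> u \<longrightarrow> (\<exists>y. (\<forall>w. w \<epsilon> y \<longleftrightarrow> w \<epsilon> x \<or> w = x) \<and> y \<epsilon> u))"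
    using ZF[of "ax_infinity 0"]
    by (simp add: ZF_def ax_infinity_def is_inductive_def is_empty_def is_succ_def)
  then obtain u where u: "ind u" unfolding ind_def eq_emp[symmetric] eq_succ[symmetric] by blast
  let ?w = "Sep u (\<lambda>x. \<forall>v. ind v \<longrightarrow> x \<epsilon> v)"
  have "x \<epsilon> ?w \<longleftrightarrow> x \<epsilon> u \<and> (\<forall>v. ind v \<longrightarrow> x \<epsilon> v)" for x
    by (rule mem_Sep) (intro definable_intros)
  then have "ind ?w \<and> (\<forall>v. ind v \<longrightarrow> sub ?w v)"
    using u by (auto simp: ind_def sub_def)
  moreover have "w = w'" if "ind w \<and> (\<forall>v. ind v \<longrightarrow> sub w v)" "ind w' \<and> (\<forall>v. ind v \<longrightarrow> sub w' v)" for w w'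
  proof (rule extensionality)
    have "sub w w'" "sub w' w" using that by blast+
    then show "z \<epsilon> w \<longleftrightarrow> z \<epsilon> w'" for z unfolding sub_def by blast
  qed
  ultimately have "\<exists>!w. ind w \<and> (\<forall>v. ind v \<longrightarrow> sub w v)" by blast
  from theI'[OF this] this show ?thesis unfolding omega_def by blast
qed

lemma emp_mem_omega [simp]: "emp \<epsilon> omega"
  and succ_mem_omega [simp]: "n \<epsilon> omega \<Longrightarrow> succ n \<epsilon> omega"
  using omega_iff[of omega] by (auto simp: ind_def)

text \<open>The numbers satisfying \<open>P\<close> form an inductive set. Definability of
  \<open>P\<close> is essential: \<open>omega\<close> is least only among the sets of the model and
  may have nonstandard elements.\<close>

lemma omega_induct [consumes 2, case_names zero succ]:
  assumes n: "n \<epsilon> omega" and P: "definable (\<lambda>e. P (e 0))"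
    and "P emp" and "\<And>n. n \<epsilon> omega \<Longrightarrow> P n \<Longrightarrow> P (succ n)"
  shows "P n"
proof -
  have *: "x \<epsilon> Sep omega P \<longleftrightarrow> x \<epsilon> omega \<and> P x" for x
    by (rule mem_Sep[OF P])
  then have "ind (Sep omega P)" using assms(3,4) by (auto simp: ind_def)
  then show ?thesis using omega_iff[of omega] n * by (auto simp: sub_def)
qed

lemma mem_omega_trans: "n \<epsilon> omega \<Longrightarrow> m \<epsilon> n \<Longrightarrow> m \<epsilon> omega"
proof -
  assume "n \<epsilon> omega" moreover have "definable (\<lambda>e. sub (e 0) omega)" by (intro definable_intros)
  ultimately have "sub n omega" by (induction n rule: omega_induct) (auto simp: sub_def)
  then show "m \<epsilon> n \<Longrightarrow> m \<epsilon> omega" by (simp add: sub_def)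
qed

lemma nat_trans: "n \<epsilon> omega \<Longrightarrow> m \<epsilon> n \<Longrightarrow> k \<epsilon> m \<Longrightarrow> k \<epsilon> n"
proof -
  assume "n \<epsilon> omega"
  moreover have "definable (\<lambda>e. \<forall>m. m \<epsilon> e 0 \<longrightarrow> sub m (e 0))" by (intro definable_intros)
  ultimately have "\<forall>m. m \<epsilon> n \<longrightarrow> sub m n" by (induction n rule: omega_induct) (auto simp: sub_def)
  then show "m \<epsilon> n \<Longrightarrow> k \<epsilon> m \<Longrightarrow> k \<epsilon> n" by (auto simp: sub_def)
qed

lemma succ_mem_cases: "n \<epsilon> omega \<Longrightarrow> m \<epsilon> n \<Longrightarrow> succ m \<epsilon> n \<or> succ m = n"
proof -
  assume "n \<epsilon> omega"
  moreover have "definable (\<lambda>e. \<forall>m. m \<epsilon> e 0 \<longrightarrow> succ m \<epsilon> e 0 \<or> succ m = e 0)"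
    by (intro definable_intros)
  ultimately have "\<forall>m. m \<epsilon> n \<longrightarrow> succ m \<epsilon> n \<or> succ m = n"
    by (induction n rule: omega_induct) auto
  then show "m \<epsilon> n \<Longrightarrow> succ m \<epsilon> n \<or> succ m = n" by blast
qed

lemma nat_linear:
  assumes "m \<epsilon> omega" and n: "n \<epsilon> omega"
  shows "m \<epsilon> n \<or> m = n \<or> n \<epsilon> m"
proof -
  have "definable (\<lambda>e. e 0 \<epsilon> n \<or> e 0 = n \<or> n \<epsilon> e 0)" by (intro definable_intros)
  with assms(1) show ?thesis
  proof (induction m rule: omega_induct)
    case zero
    have "definable (\<lambda>e. emp \<epsilon> e 0 \<or> emp = e 0)" by (intro definable_intros)
    with n have "emp \<epsilon> n \<or> emp = n" by (induction n rule: omega_induct) auto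
    then show ?case by blast
  next
    case (succ m)
    then show ?case using succ_mem_cases[OF n, of m] by auto
  qed
qed

text \<open>For a nonempty \<open>P\<close>, the intersection of all its members is the least one.\<close>

definition least :: "('a \<Rightarrow> bool) \<Rightarrow> 'a" where
  "least P = Sep omega (\<lambda>k. \<forall>m. m \<epsilon> omega \<and> P m \<longrightarrow> k \<epsilon> m)"

lemma definable_term_least [definable_intros]:
  assumes "definable (\<lambda>e. P (e 0) (\<lambda>k. e (Suc k)))"
  shows "definable_term (\<lambda>e. least (\<lambda>x. P x e))"
  unfolding least_def
  by (intro definable_intros) (use definable_rename[OF assms, of "case_nat 0 (\<lambda>k. Suc (Suc k))"] in simp)

text \<open>Foundation for the set of numbers satisfying \<open>P\<close> gives a membership-minimal
  \<open>m\<close>. By linearity and transitivity \<open>m\<close> is contained in each of these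
  numbers, so it equals their intersection.\<close>

lemma least:
  assumes P: "definable (\<lambda>e. P (e 0))" and "n \<epsilon> omega" "P n"
  shows "least P \<epsilon> omega" "P (least P)"
proof -
  have "x \<epsilon> Sep omega P \<longleftrightarrow> x \<epsilon> omega \<and> P x" for x
    by (rule mem_Sep[OF P])
  then obtain m where m: "m \<epsilon> omega" "P m" "\<And>k. k \<epsilon> m \<Longrightarrow> \<not> (k \<epsilon> omega \<and> P k)"
    using foundation[of n "Sep omega P"] assms(2,3) by auto
  have *: "k \<epsilon> least P \<longleftrightarrow> k \<epsilon> omega \<and> (\<forall>m. m \<epsilon> omega \<and> P m \<longrightarrow> k \<epsilon> m)" for k
    unfolding least_def by (intro mem_Sep definable_intros definable_subst1[OF P])
  have "least P = m"
  proof (rule extensionality)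
    fix k
    have "k \<epsilon> m'" if "k \<epsilon> m" "m' \<epsilon> omega" "P m'" for m'
      using nat_linear[OF m(1) that(2)] m(3) that nat_trans by blast
    then show "k \<epsilon> least P \<longleftrightarrow> k \<epsilon> m"
      using m(1,2) * mem_omega_trans by blast
  qed
  then show "least P \<epsilon> omega" "P (least P)" using m by auto
qed

section \<open>Equipotence and finite sets\<close>

definition ext :: "'a \<Rightarrow> 'a set" where "ext a = {x. x \<epsilon> a}"

lemma mem_ext [simp]: "x \<in> ext a \<longleftrightarrow> x \<epsilon> a"
  by (simp add: ext_def)

definition eqp :: "'a \<Rightarrow> 'a \<Rightarrow> bool" where
  "eqp a b \<longleftrightarrow> (\<exists>f. (is_fun f a \<and> (\<forall>x y. pair x y \<epsilon> f \<longrightarrow> y \<epsilon> b)) \<and>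
    (\<forall>y. y \<epsilon> b \<longrightarrow> (\<exists>!x. pair x y \<epsilon> f)))"

text \<open>Finite in the sense of the model: \<open>n\<close> may be nonstandard, so
  \<open>ext x\<close> can be infinite in HOL.\<close>

definition fin :: "'a \<Rightarrow> bool" where "fin x \<longleftrightarrow> (\<exists>n. n \<epsilon> omega \<and> eqp x n)"
definition ctbl :: "'a \<Rightarrow> bool" where "ctbl x \<longleftrightarrow> (\<exists>s. sub s omega \<and> eqp x s)"

lemma definable_eqp [definable_intros]:
  "definable_term F \<Longrightarrow> definable_term G \<Longrightarrow> definable (\<lambda>e. eqp (F e) (G e))"
  by (rule definable_subst2[where P = eqp]) (unfold eqp_def Ex1_def, intro definable_intros)

lemma definable_fin [definable_intros]: "definable_term F \<Longrightarrow> definable (\<lambda>e. fin (F e))"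
  by (rule definable_subst1[where P = fin]) (unfold fin_def, intro definable_intros)

text \<open>Together with \<open>eqpE\<close> this trades internal bijections for definable HOL
  functions that are bijective on extensions, so that facts on \<open>bij_betw\<close>
  apply.\<close>

lemma eqpI:
  assumes f: "definable_fun f" and bij: "bij_betw f (ext a) (ext b)"
  shows "eqp a b"
  unfolding eqp_def
proof (intro exI[of _ "lam a f"] conjI is_fun_lam[OF f] allI impI)
  fix x y assume "pair x y \<epsilon> lam a f"
  then show "y \<epsilon> b" using bij by (auto simp: pair_mem_lam[OF f] bij_betw_def)
next
  fix y assume "y \<epsilon> b"
  then have "y \<in> f ` ext a" using bij by (simp add: bij_betw_def)
  then obtain x where "x \<in> ext a" "y = f x" by blast
  then show "\<exists>!x. pair x y \<epsilon> lam a f"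
    using bij by (intro ex1I[of _ x]) (auto simp: pair_mem_lam[OF f] bij_betw_def inj_on_def)
qed

lemma eqpE:
  assumes "eqp a b"
  obtains f where "definable_fun f" "bij_betw f (ext a) (ext b)"
proof -
  from assms obtain f where f: "is_fun f a" "\<And>x y. pair x y \<epsilon> f \<Longrightarrow> y \<epsilon> b"
    "\<And>y. y \<epsilon> b \<Longrightarrow> \<exists>!x. pair x y \<epsilon> f"
    unfolding eqp_def by blast
  have "definable_fun (app f)" by (intro definable_intros)
  moreover have "bij_betw (app f) (ext a) (ext b)"
    unfolding bij_betw_def inj_on_def
  proof (intro conjI ballI impI)
    fix x x' assume *: "x \<in> ext a" "x' \<in> ext a" "app f x = app f x'"
    then have "pair x (app f x) \<epsilon> f" "pair x' (app f x) \<epsilon> f"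
      by (simp_all add: app_eq[OF f(1)])
    then show "x = x'" using f(2,3) by blast
  next
    show "app f ` ext a = ext b"
    proof (intro set_eqI iffI)
      fix y assume "y \<in> app f ` ext a"
      then obtain x where "x \<epsilon> a" "y = app f x" by auto
      then show "y \<in> ext b" using f(2) app_eq[OF f(1)] by simp blast
    next
      fix y assume "y \<in> ext b"
      then obtain x where "pair x y \<epsilon> f" using f(3)[of y] by (auto simp: Ex1_def)
      then show "y \<in> app f ` ext a" using app_eq[OF f(1)] is_fun_dom[OF f(1)] by fastforce
    qed
  qed
  ultimately show ?thesis by (rule that)
qed

text \<open>On the image of \<open>f\<close> the set of preimages is a singleton, whose union is the preimage.\<close>

definition preimage :: "'a \<Rightarrow> ('a \<Rightarrow> 'a) \<Rightarrow> 'a \<Rightarrow> 'a" where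
  "preimage a f y = BigUn (Sep a (\<lambda>x. f x = y))"

lemma definable_fun_preimage:
  assumes "definable_fun f"
  shows "definable_fun (preimage a f)"
  unfolding preimage_def by (intro definable_intros definable_fun_comp[OF assms])

lemma preimage:
  assumes f: "definable_fun f" and inj: "inj_on f (ext a)" and x: "x \<epsilon> a"
  shows "preimage a f (f x) = x"
proof -
  have "z \<epsilon> Sep a (\<lambda>z. f z = f x) \<longleftrightarrow> z \<epsilon> a \<and> f z = f x" for z
    by (intro mem_Sep definable_intros definable_fun_comp[OF f])
  then have "z \<epsilon> Sep a (\<lambda>z. f z = f x) \<longleftrightarrow> z = x" for z
    using inj x by (auto simp: inj_on_def)
  then show ?thesis unfolding preimage_def by (intro extensionality) simp
qed

lemma eqp_refl: "eqp x x"
  by (rule eqpI[of "\<lambda>x. x"]) (auto intro: definable_intros simp: bij_betw_def)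

lemma ext_cons [simp]: "ext (cons y x) = insert y (ext x)"
  by auto

lemma ext_succ [simp]: "ext (succ x) = insert x (ext x)"
  by auto

lemma ext_emp [simp]: "ext emp = {}"
  by auto

lemma fin_emp [simp]: "fin emp"
  unfolding fin_def by (intro exI[of _ emp]) (simp add: eqp_refl)

lemma fin_cons: 
  assumes "fin x"
  shows "fin (cons y x)"
proof (cases "y \<epsilon> x")
  case True
  then have "cons y x = x" by (intro extensionality) auto
  with assms show ?thesis by simp
next
  case False
  obtain n f where n: "n \<epsilon> omega" and f: "definable_fun f" "bij_betw f (ext x) (ext n)"
    using assms unfolding fin_def by (auto elim: eqpE)
  \<comment> \<open>The new element gets the value \<open>n\<close>, the one element by which
    \<open>succ n\<close> exceeds \<open>n\<close>.\<close>
  let ?g = "\<lambda>z. if z = y then n else f z"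
  have "eqp (cons y x) (succ n)"
  proof (rule eqpI)
    show "definable_fun ?g" by (intro definable_intros definable_fun_comp[OF f(1)])
    have "bij_betw ?g (ext x) (ext n)"
      using f(2) False by (simp cong: bij_betw_cong) (smt (verit) bij_betw_cong mem_ext)
    then show "bij_betw ?g (ext (cons y x)) (ext (succ n))"
      using notIn_Un_bij_betw[of y "ext x" ?g "ext n"] False not_mem_self[of n] by simp
  qed
  then show ?thesis unfolding fin_def using n succ_mem_omega by blast
qed

text \<open>Induction on the cardinality \<open>n\<close>, for all sets of that size at once: from a
  set of size \<open>succ n\<close> the element mapped to \<open>n\<close> is removed.\<close>

lemma fin_induct [consumes 2, case_names emp cons]:
  assumes "fin x" and P: "definable (\<lambda>e. P (e 0))"
    and emp: "P emp" and cons: "\<And>x y. fin x \<Longrightarrow> P x \<Longrightarrow> P (cons y x)"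
  shows "P x"
proof -
  obtain n where n: "n \<epsilon> omega" "eqp x n" using assms(1) unfolding fin_def by blast
  have "definable (\<lambda>e. \<forall>x. eqp x (e 0) \<longrightarrow> P x)"
    by (intro definable_intros definable_subst1[OF P])
  with n(1) have "\<forall>x. eqp x n \<longrightarrow> P x"
  proof (induction n rule: omega_induct)
    case zero
    have "x = emp" if "eqp x emp" for x
    proof -
      from that obtain f where "bij_betw f (ext x) (ext emp)" by (rule eqpE)
      then have "ext x = {}" by (simp add: bij_betw_def)
      then show ?thesis unfolding eq_emp using mem_ext by blast
    qed
    then show ?case using emp by blast
  next
    case (succ n)
    show ?case
    proof (intro allI impI)
      fix x assume "eqp x (succ n)"
      then obtain f where f: "definable_fun f" "bij_betw f (ext x) (ext (succ n))" by (rule eqpE)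
      then have "n \<in> f ` ext x" by (simp add: bij_betw_def)
      then obtain y where y: "y \<epsilon> x" "f y = n" by auto
      let ?x = "sdiff x (upair y y)"
      have e: "ext ?x = ext x - {y}" by auto
      have "bij_betw f (ext ?x) (ext n)"
        using bij_betw_DiffI[OF f(2), of "{y}" "{n}"] y not_mem_self[of n] 
        unfolding e by (auto simp: bij_betw_def)
      then have "eqp ?x n" using f(1) by (intro eqpI)
      then have "P (cons y ?x)" using succ by (intro cons) (auto simp: fin_def)
      moreover have "cons y ?x = x" using y(1) by (intro extensionality) auto
      ultimately show "P x" by simp
    qed
  qed
  then show ?thesis using \<open>eqp x n\<close> by blast
qed

lemma fin_cup: 
  assumes "fin x" "fin y"
  shows "fin (cup x y)"
proof -
  have "definable (\<lambda>e. fin (cup (e 0) y))" by (intro definable_intros)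
  with assms(1) show ?thesis
  proof (induction x rule: fin_induct)
    case emp
    have "cup emp y = y" by (intro extensionality) simp
    then show ?case using assms(2) by simp
  next
    case (cons x z)
    have "cup (cons z x) y = cons z (cup x y)" by (intro extensionality) auto
    then show ?case using cons fin_cons by simp
  qed
qed

lemma fin_sub:
  assumes "fin x" "sub y x"
  shows "fin y"
proof -
  have "definable (\<lambda>e. \<forall>y. sub y (e 0) \<longrightarrow> fin y)" by (intro definable_intros)
  with assms(1) have "\<forall>y. sub y x \<longrightarrow> fin y"
  proof (induction x rule: fin_induct)
    case emp
    have "y = emp" if "sub y emp" for y using that by (simp add: eq_emp sub_def)
    then show ?case using fin_emp by metis
  next
    case (cons x z)
    show ?case
    proof (intro allI impI)
      fix y assume y: "sub y (cons z x)"
      let ?y = "sdiff y (upair z z)"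
      have "sub ?y x" using y by (auto simp: sub_def)
      then have fin: "fin ?y" using cons(2) by blast
      show "fin y"
      proof (cases "z \<epsilon> y")
        case True
        then have "cons z ?y = y" by (intro extensionality) auto
        then show ?thesis using fin_cons[OF fin, of z] by simp
      next
        case False
        then have "?y = y" by (intro extensionality) auto
        then show ?thesis using fin by simp
      qed
    qed
  qed
  then show ?thesis using assms(2) by blast
qed

lemma fin_singleton: "fin (upair x x)"
proof -
  have "upair x x = cons x emp" by (intro extensionality) auto
  then show ?thesis by (simp add: fin_cons)
qed

text \<open>Every finite set of natural numbers is bounded.\<close>

lemma not_fin_omega: "\<not> fin omega"
proof
  have def: "definable (\<lambda>e. sub (e 0) omega \<longrightarrow> (\<exists>n. n \<epsilon> omega \<and> sub (e 0) n))"
    by (intro definable_intros)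
  have "sub x omega \<longrightarrow> (\<exists>n. n \<epsilon> omega \<and> sub x n)" if "fin x" for x
    using that def
  proof (induction x rule: fin_induct)
    case emp
    show ?case by (auto intro!: exI[of _ emp] simp: sub_def)
  next
    case (cons x m)
    show ?case
    proof
      assume s: "sub (cons m x) omega"
      then have m: "m \<epsilon> omega" "sub x omega" by (auto simp: sub_def)
      then obtain n where n: "n \<epsilon> omega" "sub x n" using cons by blast
      show "\<exists>n. n \<epsilon> omega \<and> sub (cons m x) n"
      proof (cases "m \<epsilon> n")
        case True
        then show ?thesis using n by (auto simp: sub_def)
      next
        case False
        then have "sub n (succ m)"
          using nat_linear[OF m(1) n(1)] nat_trans[OF m(1)] by (auto simp: sub_def)
        then show ?thesis using n m(1) by (intro exI[of _ "succ m"]) (auto simp: sub_def)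
      qed
    qed
  qed
  moreover assume "fin omega"
  ultimately show False using not_mem_self by (auto simp: sub_def)
qed

section \<open>Countable sets\<close>

lemma ctbl_iff:
  "ctbl x \<longleftrightarrow> (\<exists>g. definable_fun g \<and> inj_on g (ext x) \<and> (\<forall>y. y \<epsilon> x \<longrightarrow> g y \<epsilon> omega))"
proof
  assume "ctbl x"
  then obtain s g where "sub s omega" "definable_fun g" "bij_betw g (ext x) (ext s)"
    unfolding ctbl_def by (auto elim: eqpE)
  moreover from this have "g y \<in> ext s" if "y \<epsilon> x" for y
    using that by (auto dest: bij_betwE)
  ultimately show "\<exists>g. definable_fun g \<and> inj_on g (ext x) \<and> (\<forall>y. y \<epsilon> x \<longrightarrow> g y \<epsilon> omega)"
    by (intro exI[of _ g]) (auto simp: bij_betw_def sub_def)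
next
  assume "\<exists>g. definable_fun g \<and> inj_on g (ext x) \<and> (\<forall>y. y \<epsilon> x \<longrightarrow> g y \<epsilon> omega)"
  then obtain g where g: "definable_fun g" "inj_on g (ext x)" "\<And>y. y \<epsilon> x \<Longrightarrow> g y \<epsilon> omega" by blast
  have "eqp x (Img x g)"
    using g(1,2) by (intro eqpI) (auto simp: bij_betw_def mem_Img_fun[OF g(1)])
  moreover have "sub (Img x g) omega" using g(3) by (auto simp: sub_def mem_Img_fun[OF g(1)])
  ultimately show "ctbl x" unfolding ctbl_def by blast
qed

lemma ctbl_Img:
  assumes "ctbl x" and f: "definable_fun f" "inj_on f (ext x)"
  shows "ctbl (Img x f)"
proof -
  obtain g where g: "definable_fun g" "inj_on g (ext x)" "\<And>y. y \<epsilon> x \<Longrightarrow> g y \<epsilon> omega"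
    using assms(1) unfolding ctbl_iff by blast
  note pre = definable_fun_preimage[OF f(1), of x]
  show ?thesis unfolding ctbl_iff
  proof (intro exI[of _ "\<lambda>y. g (preimage x f y)"] conjI allI impI)
    show "definable_fun (\<lambda>y. g (preimage x f y))"
      by (intro definable_fun_comp[OF g(1)] pre)
    show "inj_on (\<lambda>y. g (preimage x f y)) (ext (Img x f))"
    proof (rule inj_onI)
      fix u v
      assume "u \<in> ext (Img x f)" "v \<in> ext (Img x f)"
        and eq: "g (preimage x f u) = g (preimage x f v)"
      then obtain y z where *: "y \<epsilon> x" "z \<epsilon> x" "u = f y" "v = f z"
        by (auto simp: mem_Img_fun[OF f(1)])
      then have "g y = g z" using eq by (simp add: preimage[OF f])
      then have "y = z" using g(2) * by (simp add: inj_on_def)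
      then show "u = v" using * by simp
    qed
    show "g (preimage x f y) \<epsilon> omega" if "y \<epsilon> Img x f" for y
      using that g(3) by (auto simp: mem_Img_fun[OF f(1)] preimage[OF f])
  qed
qed

text \<open>Repetitions are allowed, so finite and infinite countable sets are treated alike.
  Numbers outside the range of the injection \<open>g\<close> are sent to the given element
  \<open>u\<close>.\<close>

lemma ctbl_surj:
  assumes "ctbl x" "u \<epsilon> x"
  obtains h where "definable_fun h" "\<And>y. y \<epsilon> x \<longleftrightarrow> (\<exists>n. n \<epsilon> omega \<and> y = h n)"
proof -
  obtain g where g: "definable_fun g" "inj_on g (ext x)" "\<And>y. y \<epsilon> x \<Longrightarrow> g y \<epsilon> omega"
    using assms(1) unfolding ctbl_iff by blast
  let ?h = "\<lambda>n. if \<exists>y. y \<epsilon> x \<and> g y = n then preimage x g n else u"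
  have "definable_fun ?h"
    by (intro definable_intros definable_fun_preimage g(1) definable_fun_comp[OF g(1)])
  moreover have "y \<epsilon> x \<longleftrightarrow> (\<exists>n. n \<epsilon> omega \<and> y = ?h n)" for y
  proof
    assume "y \<epsilon> x"
    then show "\<exists>n. n \<epsilon> omega \<and> y = ?h n"
      using g(3) by (intro exI[of _ "g y"]) (auto simp: preimage[OF g(1,2)])
  next
    assume "\<exists>n. n \<epsilon> omega \<and> y = ?h n"
    then show "y \<epsilon> x" using assms(2) preimage[OF g(1,2)] by (auto split: if_splits)
  qed
  ultimately show ?thesis by (rule that)
qed


section \<open>The choice principles inside a model\<close>

lemma sat_is_empty [simp]: "in_scope x d \<Longrightarrow> sats e (is_empty x d) \<longleftrightarrow> e (x d) = emp"
  by (simp add: is_empty_def eq_emp)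

lemma sat_is_nonempty [simp]: "in_scope x d \<Longrightarrow> sats e (is_nonempty x d) \<longleftrightarrow> (\<exists>z. z \<epsilon> e (x d))"
  by (simp add: is_nonempty_def)

lemma sat_is_subset [simp]:
  "in_scope x d \<Longrightarrow> in_scope y d \<Longrightarrow> sats e ((x \<^bold>\<subseteq> y) d) \<longleftrightarrow> sub (e (x d)) (e (y d))"
  by (simp add: is_subset_def sub_def)

lemma sat_is_upair [simp]:
  "in_scope z d \<Longrightarrow> in_scope x d \<Longrightarrow> in_scope y d \<Longrightarrow>
    sats e (is_upair z x y d) \<longleftrightarrow> e (z d) = upair (e (x d)) (e (y d))"
  by (simp add: is_upair_def eq_upair)

lemma sat_is_pair [simp]:
  "in_scope z d \<Longrightarrow> in_scope x d \<Longrightarrow> in_scope y d \<Longrightarrow>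
    sats e (is_pair z x y d) \<longleftrightarrow> e (z d) = pair (e (x d)) (e (y d))"
  by (simp add: is_pair_def pair_def eq_upair[of "e (z d)"])

lemma sat_is_un [simp]:
  "in_scope z d \<Longrightarrow> in_scope x d \<Longrightarrow> in_scope y d \<Longrightarrow>
    sats e (is_un z x y d) \<longleftrightarrow> e (z d) = cup (e (x d)) (e (y d))"
  using extensionality[of "e (z d)" "cup (e (x d)) (e (y d))"] by (auto simp: is_un_def)

lemma sat_is_int [simp]:
  "in_scope z d \<Longrightarrow> in_scope x d \<Longrightarrow> in_scope y d \<Longrightarrow>
    sats e (is_int z x y d) \<longleftrightarrow> e (z d) = cap (e (x d)) (e (y d))"
  using extensionality[of "e (z d)" "cap (e (x d)) (e (y d))"] by (auto simp: is_int_def)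

lemma sat_is_succ [simp]:
  "in_scope z d \<Longrightarrow> in_scope x d \<Longrightarrow> sats e (is_succ z x d) \<longleftrightarrow> e (z d) = succ (e (x d))"
  by (simp add: is_succ_def eq_succ)

lemma sat_is_omega [simp]: "in_scope w d \<Longrightarrow> sats e (is_omega w d) \<longleftrightarrow> e (w d) = omega"
  by (simp add: is_omega_def is_inductive_def omega_iff ind_def)

lemma sat_is_prod [simp]:
  "in_scope p d \<Longrightarrow> in_scope a d \<Longrightarrow> in_scope b d \<Longrightarrow>
    sats e (is_prod p a b d) \<longleftrightarrow> e (p d) = cross (e (a d)) (e (b d))"
  using extensionality[of "e (p d)" "cross (e (a d)) (e (b d))"]
  by (auto simp: is_prod_def simp del: mem_cross) (auto simp: mem_cross)

lemma sat_maps_to [simp]: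
  "in_scope f d \<Longrightarrow> in_scope x d \<Longrightarrow> in_scope y d \<Longrightarrow>
    sats e (maps_to f x y d) \<longleftrightarrow> pair (e (x d)) (e (y d)) \<epsilon> e (f d)"
  by (simp add: maps_to_def)

lemma sat_fun_on [simp]:
  "in_scope f d \<Longrightarrow> in_scope a d \<Longrightarrow> sats e (fun_on f a d) \<longleftrightarrow> is_fun (e (f d)) (e (a d))"
  by (simp add: fun_on_def fEx1_def is_fun_def Ex1_def)

lemma sat_fun_into [simp]:
  "in_scope f d \<Longrightarrow> in_scope a d \<Longrightarrow> in_scope b d \<Longrightarrow> sats e (fun_into f a b d) \<longleftrightarrow>
    is_fun (e (f d)) (e (a d)) \<and> (\<forall>x y. pair x y \<epsilon> e (f d) \<longrightarrow> y \<epsilon> e (b d))"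
  by (simp add: fun_into_def)

lemma sat_equipotent [simp]:
  "in_scope a d \<Longrightarrow> in_scope b d \<Longrightarrow> sats e (equipotent a b d) \<longleftrightarrow> eqp (e (a d)) (e (b d))"
  by (simp add: equipotent_def bijection_def fEx1_def eqp_def Ex1_def)

lemma sat_is_finite [simp]: "in_scope x d \<Longrightarrow> sats e (is_finite x d) \<longleftrightarrow> fin (e (x d))"
  by (simp add: is_finite_def fin_def)

lemma sat_is_countable [simp]: "in_scope x d \<Longrightarrow> sats e (is_countable x d) \<longleftrightarrow> ctbl (e (x d))"
  by (simp add: is_countable_def ctbl_def)

section \<open>The principles restated for definable functions\<close>

lemma sat_CMC:
  "sats e (CMC d) \<longleftrightarrow> (\<forall>J F. \<not> fin J \<and> ctbl J \<and> is_fun F J \<and> (\<forall>j A. pair j A \<epsilon> F \<longrightarrow> (\<exists>z. z \<epsilon> A)) \<longrightarrow>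
    (\<exists>C. is_fun C J \<and> (\<forall>j A B. pair j A \<epsilon> F \<and> pair j B \<epsilon> C \<longrightarrow> (\<exists>z. z \<epsilon> B) \<and> fin B \<and> sub B A)))"
  by (simp add: CMC_def multiple_choice_fun_def is_denumerable_def)

lemma sat_CMC_omega:
  "sats e (CMC_omega d) \<longleftrightarrow> (\<forall>J F. \<not> fin J \<and> ctbl J \<and> is_fun F J \<and> (\<forall>j A. pair j A \<epsilon> F \<longrightarrow> \<not> fin A \<and> ctbl A) \<longrightarrow>
    (\<exists>C. is_fun C J \<and> (\<forall>j A B. pair j A \<epsilon> F \<and> pair j B \<epsilon> C \<longrightarrow> (\<exists>z. z \<epsilon> B) \<and> fin B \<and> sub B A)))"
  by (simp add: CMC_omega_def multiple_choice_fun_def is_denumerable_def)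

text \<open>Families in the formula are sets of pairs: the definable family becomes such a set by
  \<open>lam\<close>, and the resulting choice set becomes a definable function by
  \<open>app\<close>.\<close>

lemma CMC_choice:
  assumes "sats e (CMC d)" "\<not> fin J" "ctbl J" and F: "definable_fun F"
    and ne: "\<And>j. j \<epsilon> J \<Longrightarrow> \<exists>z. z \<epsilon> F j"
  obtains C where "definable_fun C"
    and "\<And>j. j \<epsilon> J \<Longrightarrow> (\<exists>z. z \<epsilon> C j) \<and> fin (C j) \<and> sub (C j) (F j)"
proof -
  have "\<exists>C. is_fun C J \<and> (\<forall>j A B. pair j A \<epsilon> lam J F \<and> pair j B \<epsilon> C \<longrightarrow> (\<exists>z. z \<epsilon> B) \<and> fin B \<and> sub B A)"
    using assms(1)[unfolded sat_CMC, rule_format, of J "lam J F"] assms(2,3) ne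
    by (simp add: is_fun_lam[OF F] pair_mem_lam[OF F])
  then obtain C where C: "is_fun C J"
    "\<And>j B. j \<epsilon> J \<Longrightarrow> pair j B \<epsilon> C \<Longrightarrow> (\<exists>z. z \<epsilon> B) \<and> fin B \<and> sub B (F j)"
    by (auto simp: pair_mem_lam[OF F])
  have "definable_fun (app C)" by (intro definable_intros)
  then show ?thesis using C app_eq[OF C(1)] by (intro that[of "app C"]) blast+
qed

lemma CMC_omegaI:
  assumes "\<And>J F. definable_fun F \<Longrightarrow> \<not> fin J \<Longrightarrow> ctbl J \<Longrightarrow>
    (\<And>j. j \<epsilon> J \<Longrightarrow> \<not> fin (F j) \<and> ctbl (F j)) \<Longrightarrow>
    \<exists>C. definable_fun C \<and> (\<forall>j. j \<epsilon> J \<longrightarrow> (\<exists>z. z \<epsilon> C j) \<and> fin (C j) \<and> sub (C j) (F j))"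
  shows "sats e (CMC_omega d)"
  unfolding sat_CMC_omega
proof (intro allI impI; elim conjE)
  fix J F
  assume J: "\<not> fin J" "ctbl J" "is_fun F J" "\<forall>j A. pair j A \<epsilon> F \<longrightarrow> \<not> fin A \<and> ctbl A"
  have "definable_fun (app F)" by (intro definable_intros)
  with J obtain C where C: "definable_fun C"
    "\<And>j. j \<epsilon> J \<Longrightarrow> (\<exists>z. z \<epsilon> C j) \<and> fin (C j) \<and> sub (C j) (app F j)"
    using assms[of "app F" J] app_eq[OF J(3)] by blast
  show "\<exists>C. is_fun C J \<and> (\<forall>j A B. pair j A \<epsilon> F \<and> pair j B \<epsilon> C \<longrightarrow> (\<exists>z. z \<epsilon> B) \<and> fin B \<and> sub B A)"
    using C(2) app_eq[OF J(3)]
    by (intro exI[of _ "lam J C"]) (auto simp: is_fun_lam[OF C(1)] pair_mem_lam[OF C(1)])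
qed

text \<open>Membership of \<open>z\<close> in the union (\<open>b = True\<close>) or intersection (\<open>b = False\<close>) of \<open>Q\<close>.\<close>

definition big_op :: "bool \<Rightarrow> ('a \<Rightarrow> bool) \<Rightarrow> 'a \<Rightarrow> bool" where
  "big_op b Q z \<longleftrightarrow> (if b then \<exists>y. Q y \<and> z \<epsilon> y else \<forall>y. Q y \<longrightarrow> z \<epsilon> y)"

lemma definable_big_op: "definable (\<lambda>e. big_op b (\<lambda>y. y \<epsilon> a) (e 0))"
  unfolding big_op_def by (cases b; simp only: if_True if_False; intro definable_intros)

text \<open>One statement covers both principles, so that duality can be proved once, from
  \<open>b\<close> to its negation.\<close>

definition A_sem :: "bool \<Rightarrow> bool" where
  "A_sem b \<longleftrightarrow> (\<forall>X \<A> U. (\<forall>A. A \<epsilon> \<A> \<longrightarrow> sub A X) \<and>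
     (\<forall>A B. A \<epsilon> \<A> \<and> B \<epsilon> \<A> \<longrightarrow> cup A B \<epsilon> \<A>) \<and> (\<forall>A B. A \<epsilon> \<A> \<and> B \<epsilon> \<A> \<longrightarrow> cap A B \<epsilon> \<A>) \<and>
     is_fun U omega \<and> (\<forall>n u. pair n u \<epsilon> U \<longrightarrow> (\<exists>z. z \<epsilon> u) \<and> ctbl u \<and> sub u \<A>) \<longrightarrow>
     (\<exists>V. (is_fun V (cross omega omega) \<and> (\<forall>x y. pair x y \<epsilon> V \<longrightarrow> y \<epsilon> \<A>)) \<and>
       (\<forall>n u. pair n u \<epsilon> U \<longrightarrow> (\<exists>R S. (\<forall>v. v \<epsilon> R \<longleftrightarrow> (\<exists>m. m \<epsilon> omega \<and> pair (pair n m) v \<epsilon> V)) \<and>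
          (\<forall>z. z \<epsilon> S \<longleftrightarrow> big_op b (\<lambda>y. y \<epsilon> u) z) \<and> (\<forall>z. z \<epsilon> S \<longleftrightarrow> big_op b (\<lambda>y. y \<epsilon> R) z)))))"

lemma sat_A_sigma_sigma: "sats e (A_sigma_sigma d) \<longleftrightarrow> A_sem True"
  by (simp add: A_sigma_sigma_def A_principle_def stable_un_def stable_int_def is_row_def
      is_Union_def A_sem_def big_op_def)

lemma sat_A_delta_delta: "sats e (A_delta_delta d) \<longleftrightarrow> A_sem False"
  by (simp add: A_delta_delta_def A_principle_def stable_un_def stable_int_def is_row_def
      is_Inter_def A_sem_def big_op_def)

text \<open>The hypotheses of \<open>A_sem\<close> with the sequence given as a definable function.
  The matching conclusion, \<open>resolves\<close>, compares unions or intersections pointwise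
  instead of forming them as sets.\<close>

definition admissible :: "'a \<Rightarrow> 'a \<Rightarrow> ('a \<Rightarrow> 'a) \<Rightarrow> bool" where
  "admissible X \<A> u \<longleftrightarrow> definable_fun u \<and> (\<forall>A. A \<epsilon> \<A> \<longrightarrow> sub A X) \<and>
    (\<forall>A B. A \<epsilon> \<A> \<longrightarrow> B \<epsilon> \<A> \<longrightarrow> cup A B \<epsilon> \<A> \<and> cap A B \<epsilon> \<A>) \<and>
    (\<forall>n. n \<epsilon> omega \<longrightarrow> (\<exists>z. z \<epsilon> u n) \<and> ctbl (u n) \<and> sub (u n) \<A>)"

definition resolves :: "bool \<Rightarrow> 'a \<Rightarrow> ('a \<Rightarrow> 'a) \<Rightarrow> ('a \<Rightarrow> 'a \<Rightarrow> 'a) \<Rightarrow> bool" where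
  "resolves b \<A> u v \<longleftrightarrow> definable_fun2 v \<and> (\<forall>n m. n \<epsilon> omega \<longrightarrow> m \<epsilon> omega \<longrightarrow> v n m \<epsilon> \<A>) \<and>
    (\<forall>n z. n \<epsilon> omega \<longrightarrow>
      (big_op b (\<lambda>y. y \<epsilon> u n) z \<longleftrightarrow> big_op b (\<lambda>y. \<exists>m. m \<epsilon> omega \<and> y = v n m) z))"

lemma A_semI:
  assumes "\<And>X \<A> u. admissible X \<A> u \<Longrightarrow> \<exists>v. resolves b \<A> u v"
  shows "A_sem b"
  unfolding A_sem_def
proof (intro allI impI; elim conjE)
  fix X \<A> U
  assume "\<forall>A. A \<epsilon> \<A> \<longrightarrow> sub A X" "\<forall>A B. A \<epsilon> \<A> \<and> B \<epsilon> \<A> \<longrightarrow> cup A B \<epsilon> \<A>"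
    "\<forall>A B. A \<epsilon> \<A> \<and> B \<epsilon> \<A> \<longrightarrow> cap A B \<epsilon> \<A>"
    and U: "is_fun U omega" "\<forall>n u. pair n u \<epsilon> U \<longrightarrow> (\<exists>z. z \<epsilon> u) \<and> ctbl u \<and> sub u \<A>"
  note U_eq = app_eq[OF U(1)]
  have "definable_fun (app U)" by (intro definable_intros)
  then have adm: "admissible X \<A> (app U)"
    unfolding admissible_def using \<open>\<forall>A. A \<epsilon> \<A> \<longrightarrow> sub A X\<close>
      \<open>\<forall>A B. A \<epsilon> \<A> \<and> B \<epsilon> \<A> \<longrightarrow> cup A B \<epsilon> \<A>\<close> \<open>\<forall>A B. A \<epsilon> \<A> \<and> B \<epsilon> \<A> \<longrightarrow> cap A B \<epsilon> \<A>\<close> U(2) U_eq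
    by blast
  then obtain v where v: "definable_fun2 v" "\<And>n m. n \<epsilon> omega \<Longrightarrow> m \<epsilon> omega \<Longrightarrow> v n m \<epsilon> \<A>"
    "\<And>n z. n \<epsilon> omega \<Longrightarrow> big_op b (\<lambda>y. y \<epsilon> app U n) z \<longleftrightarrow> big_op b (\<lambda>y. \<exists>m. m \<epsilon> omega \<and> y = v n m) z"
    using assms unfolding resolves_def by blast
  define V where "V = Sep (cross (cross omega omega) \<A>) (\<lambda>p. \<exists>n m. p = pair (pair n m) (v n m))"
  have V: "p \<epsilon> V \<longleftrightarrow> p \<epsilon> cross (cross omega omega) \<A> \<and> (\<exists>n m. p = pair (pair n m) (v n m))" for p
    unfolding V_def by (rule mem_Sep) (intro definable_intros definable_fun2_comp[OF v(1)])
  have pV: "pair (pair n m) y \<epsilon> V \<longleftrightarrow> n \<epsilon> omega \<and> m \<epsilon> omega \<and> y = v n m" for n m y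
    unfolding V using v(2) by auto
  show "\<exists>V. (is_fun V (cross omega omega) \<and> (\<forall>x y. pair x y \<epsilon> V \<longrightarrow> y \<epsilon> \<A>)) \<and>
       (\<forall>n u. pair n u \<epsilon> U \<longrightarrow> (\<exists>R S. (\<forall>v. v \<epsilon> R \<longleftrightarrow> (\<exists>m. m \<epsilon> omega \<and> pair (pair n m) v \<epsilon> V)) \<and>
          (\<forall>z. z \<epsilon> S \<longleftrightarrow> big_op b (\<lambda>y. y \<epsilon> u) z) \<and> (\<forall>z. z \<epsilon> S \<longleftrightarrow> big_op b (\<lambda>y. y \<epsilon> R) z)))"
  proof (rule exI[of _ V], intro conjI allI impI)
    show "is_fun V (cross omega omega)"
      unfolding is_fun_def by (auto simp: pV) (auto simp: V)
    show "y \<epsilon> \<A>" if "pair x y \<epsilon> V" for x y using that by (auto simp: V)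
    fix n u assume nu: "pair n u \<epsilon> U"
    then have n: "n \<epsilon> omega" by (rule is_fun_dom[OF U(1)])
    with nu have u: "u = app U n" using U_eq by blast
    have v': "definable_fun (v n)" by (intro definable_intros definable_fun2_comp[OF v(1)])
    \<comment> \<open>Since \<open>u\<close> is nonempty, the intersection is contained in the
      union, so separation from \<open>BigUn\<close> produces either of them.\<close>
    let ?R = "Img omega (v n)" and ?S = "Sep (BigUn (app U n)) (\<lambda>z. big_op b (\<lambda>y. y \<epsilon> app U n) z)"
    have R: "y \<epsilon> ?R \<longleftrightarrow> (\<exists>m. m \<epsilon> omega \<and> y = v n m)" for y by (rule mem_Img_fun[OF v'])
    obtain y where "y \<epsilon> u" using U(2) nu by blast
    have "z \<epsilon> ?S \<longleftrightarrow> z \<epsilon> BigUn (app U n) \<and> big_op b (\<lambda>y. y \<epsilon> app U n) z" for z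
      by (rule mem_Sep) (rule definable_big_op)
    then have "z \<epsilon> ?S \<longleftrightarrow> big_op b (\<lambda>y. y \<epsilon> u) z" for z
      using \<open>y \<epsilon> u\<close> unfolding u big_op_def by (auto split: if_splits)
    then show "\<exists>R S. (\<forall>v. v \<epsilon> R \<longleftrightarrow> (\<exists>m. m \<epsilon> omega \<and> pair (pair n m) v \<epsilon> V)) \<and>
          (\<forall>z. z \<epsilon> S \<longleftrightarrow> big_op b (\<lambda>y. y \<epsilon> u) z) \<and> (\<forall>z. z \<epsilon> S \<longleftrightarrow> big_op b (\<lambda>y. y \<epsilon> R) z)"
      using n v(3)[OF n] by (intro exI[of _ ?R] exI[of _ ?S]) (simp add: R pV u)
  qed
qed

lemma A_semD:
  assumes "A_sem b" and adm: "admissible X \<A> u"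
  obtains v where "resolves b \<A> u v"
proof -
  have u: "definable_fun u" using adm by (simp add: admissible_def)
  have "\<exists>V. (is_fun V (cross omega omega) \<and> (\<forall>x y. pair x y \<epsilon> V \<longrightarrow> y \<epsilon> \<A>)) \<and>
       (\<forall>n w. pair n w \<epsilon> lam omega u \<longrightarrow>
         (\<exists>R S. (\<forall>v. v \<epsilon> R \<longleftrightarrow> (\<exists>m. m \<epsilon> omega \<and> pair (pair n m) v \<epsilon> V)) \<and>
          (\<forall>z. z \<epsilon> S \<longleftrightarrow> big_op b (\<lambda>y. y \<epsilon> w) z) \<and> (\<forall>z. z \<epsilon> S \<longleftrightarrow> big_op b (\<lambda>y. y \<epsilon> R) z)))"
    using assms(1)[unfolded A_sem_def, rule_format, of \<A> X "lam omega u"] adm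
    unfolding admissible_def by (simp add: is_fun_lam[OF u] pair_mem_lam[OF u])
  then obtain V where V: "is_fun V (cross omega omega)" "\<And>x y. pair x y \<epsilon> V \<Longrightarrow> y \<epsilon> \<A>"
    and S: "\<And>n. n \<epsilon> omega \<Longrightarrow> \<exists>R S. (\<forall>v. v \<epsilon> R \<longleftrightarrow> (\<exists>m. m \<epsilon> omega \<and> pair (pair n m) v \<epsilon> V)) \<and>
          (\<forall>z. z \<epsilon> S \<longleftrightarrow> big_op b (\<lambda>y. y \<epsilon> u n) z) \<and> (\<forall>z. z \<epsilon> S \<longleftrightarrow> big_op b (\<lambda>y. y \<epsilon> R) z)"
    by (auto simp: pair_mem_lam[OF u])
  let ?v = "\<lambda>n m. app V (pair n m)"
  have V_eq: "pair (pair n m) y \<epsilon> V \<longleftrightarrow> y = ?v n m" if "n \<epsilon> omega" "m \<epsilon> omega" for n m y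
    using that by (intro app_eq[OF V(1)]) simp
  have "resolves b \<A> u ?v"
    unfolding resolves_def
  proof (intro conjI allI impI)
    show "definable_fun2 ?v" by (intro definable_intros)
    show "?v n m \<epsilon> \<A>" if "n \<epsilon> omega" "m \<epsilon> omega" for n m
      using V(2) V_eq[OF that] by blast
    fix n z assume n: "n \<epsilon> omega"
    then obtain R S where R: "\<And>v. v \<epsilon> R \<longleftrightarrow> (\<exists>m. m \<epsilon> omega \<and> pair (pair n m) v \<epsilon> V)"
      and S: "\<And>z. z \<epsilon> S \<longleftrightarrow> big_op b (\<lambda>y. y \<epsilon> u n) z" "\<And>z. z \<epsilon> S \<longleftrightarrow> big_op b (\<lambda>y. y \<epsilon> R) z"
      using S[OF n] by blast
    have "(\<lambda>y. y \<epsilon> R) = (\<lambda>y. \<exists>m. m \<epsilon> omega \<and> y = ?v n m)"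
      unfolding R using V_eq[OF n] by (intro ext) blast
    then show "big_op b (\<lambda>y. y \<epsilon> u n) z \<longleftrightarrow> big_op b (\<lambda>y. \<exists>m. m \<epsilon> omega \<and> y = ?v n m) z"
      using S by simp
  qed
  then show ?thesis by (rule that)
qed

section \<open>Duality between unions and intersections\<close>

lemma sdiff_sdiff: "sub A X \<Longrightarrow> sdiff X (sdiff X A) = A"
  by (intro extensionality) (auto simp: sub_def)

text \<open>De Morgan inside \<open>X\<close>. The witness \<open>y0\<close> excludes the empty
  family, whose intersection would not be confined to \<open>X\<close>.\<close>

lemma big_op_sdiff:
  assumes "\<And>y. Q y \<Longrightarrow> sub y X" "Q y0" "\<And>y. Q' y \<longleftrightarrow> (\<exists>x. Q x \<and> y = sdiff X x)"
  shows "big_op (\<not> b) Q z \<longleftrightarrow> z \<epsilon> X \<and> \<not> big_op b Q' z"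
  using assms unfolding big_op_def sub_def by (cases b) auto

text \<open>Complementation exchanges \<open>cup\<close> and \<open>cap\<close>, so stability under
  each gives the complemented family stability under the other. Being an involution on subsets of
  \<open>X\<close>, it preserves countability and can be undone on the result.\<close>

lemma A_sem_dual:
  assumes "A_sem b"
  shows "A_sem (\<not> b)"
proof (rule A_semI)
  fix X \<A> u
  assume adm: "admissible X \<A> u"
  then have u: "definable_fun u" and X: "\<And>A. A \<epsilon> \<A> \<Longrightarrow> sub A X"
    and stable: "\<And>A B. A \<epsilon> \<A> \<Longrightarrow> B \<epsilon> \<A> \<Longrightarrow> cup A B \<epsilon> \<A> \<and> cap A B \<epsilon> \<A>"
    and un: "\<And>n. n \<epsilon> omega \<Longrightarrow> (\<exists>z. z \<epsilon> u n) \<and> ctbl (u n) \<and> sub (u n) \<A>"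
    unfolding admissible_def by blast+
  have c: "definable_fun (sdiff X)" by (intro definable_intros)
  let ?A = "Img \<A> (sdiff X)" and ?u = "\<lambda>n. Img (u n) (sdiff X)"
  have uX: "sub y X" if "n \<epsilon> omega" "y \<epsilon> u n" for n y
    using X un[OF that(1)] that(2) by (auto simp: sub_def)
  have "admissible X ?A ?u"
    unfolding admissible_def
  proof (intro conjI allI impI)
    show "definable_fun ?u" by (intro definable_intros definable_fun_comp[OF u])
    show "sub A X" if "A \<epsilon> ?A" for A
      using that by (auto simp: mem_Img_fun[OF c] sub_def)
    fix A B assume "A \<epsilon> ?A" "B \<epsilon> ?A"
    then obtain A' B' where *: "A' \<epsilon> \<A>" "B' \<epsilon> \<A>" "A = sdiff X A'" "B = sdiff X B'"
      by (auto simp: mem_Img_fun[OF c])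
    have "cup A B = sdiff X (cap A' B')" "cap A B = sdiff X (cup A' B')"
      unfolding * by (intro extensionality; auto)+
    then show "cup A B \<epsilon> ?A" "cap A B \<epsilon> ?A"
      using stable *(1,2) by (auto simp: mem_Img_fun[OF c])
  next
    fix n assume n: "n \<epsilon> omega"
    show "\<exists>z. z \<epsilon> ?u n" using un[OF n] by (auto simp: mem_Img_fun[OF c])
    have "inj_on (sdiff X) (ext (u n))"
      using uX[OF n] sdiff_sdiff by (intro inj_on_inverseI[of _ "sdiff X"]) simp
    then show "ctbl (?u n)" using un[OF n] c by (intro ctbl_Img) auto
    show "sub (?u n) ?A" using un[OF n] by (auto simp: mem_Img_fun[OF c] sub_def)
  qed
  then obtain v where "resolves b ?A ?u v" by (rule A_semD[OF assms])
  then have v: "definable_fun2 v" "\<And>n m. n \<epsilon> omega \<Longrightarrow> m \<epsilon> omega \<Longrightarrow> v n m \<epsilon> ?A"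
    "\<And>n z. n \<epsilon> omega \<Longrightarrow> big_op b (\<lambda>y. y \<epsilon> ?u n) z \<longleftrightarrow> big_op b (\<lambda>y. \<exists>m. m \<epsilon> omega \<and> y = v n m) z"
    unfolding resolves_def by simp_all
  let ?v = "\<lambda>n m. sdiff X (v n m)"
  have v_A: "?v n m \<epsilon> \<A>" and v_eq: "v n m = sdiff X (?v n m)" if "n \<epsilon> omega" "m \<epsilon> omega" for n m
    using v(2)[OF that] X by (auto simp: mem_Img_fun[OF c] sdiff_sdiff)
  have "resolves (\<not> b) \<A> u ?v"
    unfolding resolves_def
  proof (intro conjI allI impI v_A)
    show "definable_fun2 ?v" by (intro definable_intros definable_fun2_comp[OF v(1)])
    fix n z assume n: "n \<epsilon> omega"
    obtain y where y: "y \<epsilon> u n" using un[OF n] by blast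
    have "big_op (\<not> b) (\<lambda>y. y \<epsilon> u n) z \<longleftrightarrow> z \<epsilon> X \<and> \<not> big_op b (\<lambda>y. y \<epsilon> ?u n) z"
      by (rule big_op_sdiff[of "\<lambda>y. y \<epsilon> u n" X y]) (use uX[OF n] y in \<open>auto simp: mem_Img_fun[OF c]\<close>)
    also have "\<dots> \<longleftrightarrow> z \<epsilon> X \<and> \<not> big_op b (\<lambda>y. \<exists>m. m \<epsilon> omega \<and> y = v n m) z"
      by (simp add: v(3)[OF n])
    also have "\<dots> \<longleftrightarrow> big_op (\<not> b) (\<lambda>y. \<exists>m. m \<epsilon> omega \<and> y = ?v n m) z"
    proof (rule big_op_sdiff[symmetric])
      \<comment> \<open>De Morgan requires a nonempty row; the entry with index 0 provides a
        member.\<close>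
      show "\<exists>m. m \<epsilon> omega \<and> ?v n emp = ?v n m" using emp_mem_omega by blast
      show "sub y X" if "\<exists>m. m \<epsilon> omega \<and> y = ?v n m" for y
        using that by (auto simp: sub_def)
      show "(\<exists>m. m \<epsilon> omega \<and> y = v n m) \<longleftrightarrow> (\<exists>x. (\<exists>m. m \<epsilon> omega \<and> x = ?v n m) \<and> y = sdiff X x)" for y
        using v_eq[OF n] by metis
    qed
    finally show "big_op (\<not> b) (\<lambda>y. y \<epsilon> u n) z \<longleftrightarrow> big_op (\<not> b) (\<lambda>y. \<exists>m. m \<epsilon> omega \<and> y = ?v n m) z" .
  qed
  then show "\<exists>v. resolves (\<not> b) \<A> u v" by blast
qed

section \<open>Implication (ii)\<close>

lemma ctbl_omega: "ctbl omega"
  unfolding ctbl_def using eqp_refl sub_refl by blast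

lemma fin_Img:
  assumes "fin x" and f: "definable_fun f"
  shows "fin (Img x f)"
proof -
  have "definable (\<lambda>e. fin (Img (e 0) f))"
    by (intro definable_intros definable_fun_comp[OF f])
  with assms(1) show ?thesis
  proof (induction x rule: fin_induct)
    case emp
    have "Img emp f = emp" by (intro extensionality) (simp add: mem_Img_fun[OF f])
    then show ?case by simp
  next
    case (cons x y)
    have "Img (cons y x) f = cons (f y) (Img x f)"
      by (intro extensionality) (auto simp: mem_Img_fun[OF f])
    then show ?case using cons fin_cons by simp
  qed
qed

text \<open>Nonemptiness is carried through the induction because the empty union need not belong to
  \<open>\<A>\<close>; adjoining \<open>y\<close> to the empty set is the real base case.\<close>

lemma BigUn_stable:
  assumes "fin x" "sub x \<A>" "z \<epsilon> x" and stable: "\<And>A B. A \<epsilon> \<A> \<Longrightarrow> B \<epsilon> \<A> \<Longrightarrow> cup A B \<epsilon> \<A>"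
  shows "BigUn x \<epsilon> \<A>"
proof -
  have "definable (\<lambda>e. sub (e 0) \<A> \<longrightarrow> (\<exists>z. z \<epsilon> e 0) \<longrightarrow> BigUn (e 0) \<epsilon> \<A>)"
    by (intro definable_intros)
  with assms(1) have "sub x \<A> \<longrightarrow> (\<exists>z. z \<epsilon> x) \<longrightarrow> BigUn x \<epsilon> \<A>"
  proof (induction x rule: fin_induct)
    case (cons x y)
    show ?case
    proof (intro impI)
      assume "sub (cons y x) \<A>"
      then have y: "y \<epsilon> \<A>" and x: "sub x \<A>" by (auto simp: sub_def)
      show "BigUn (cons y x) \<epsilon> \<A>"
      proof (cases "\<exists>z. z \<epsilon> x")
        case True
        have "BigUn (cons y x) = cup y (BigUn x)" by (intro extensionality) auto
        then show ?thesis using cons True x y stable by simp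
      next
        case False
        then have "BigUn (cons y x) = y" by (intro extensionality) auto
        then show ?thesis using y by simp
      qed
    qed
  qed simp
  then show ?thesis using assms(2,3) by blast
qed

lemma CMC_imp_A_sigma_sigma:
  assumes "sats e (CMC d)"
  shows "A_sem True"
proof (rule A_semI)
  fix X \<A> u
  assume adm: "admissible X \<A> u"
  then have u: "definable_fun u"
    and stable: "\<And>A B. A \<epsilon> \<A> \<Longrightarrow> B \<epsilon> \<A> \<Longrightarrow> cup A B \<epsilon> \<A>"
    and un: "\<And>n. n \<epsilon> omega \<Longrightarrow> (\<exists>z. z \<epsilon> u n) \<and> ctbl (u n) \<and> sub (u n) \<A>"
    unfolding admissible_def by blast+
  \<comment> \<open>The surjections from \<omega> onto \<open>u n\<close>, cut out of a power set so
    that the family depends definably on \<open>n\<close>.\<close>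
  let ?B = "\<lambda>n. Sep (Pw (cross omega (u n)))
    (\<lambda>f. is_fun f omega \<and> (\<forall>y. y \<epsilon> u n \<longleftrightarrow> (\<exists>m. m \<epsilon> omega \<and> pair m y \<epsilon> f)))"
  have B: "f \<epsilon> ?B n \<longleftrightarrow> f \<epsilon> Pw (cross omega (u n)) \<and>
      is_fun f omega \<and> (\<forall>y. y \<epsilon> u n \<longleftrightarrow> (\<exists>m. m \<epsilon> omega \<and> pair m y \<epsilon> f))" for f n
    by (rule mem_Sep) (intro definable_intros)
  obtain C where C: "definable_fun C"
    "\<And>n. n \<epsilon> omega \<Longrightarrow> (\<exists>f. f \<epsilon> C n) \<and> fin (C n) \<and> sub (C n) (?B n)"
  proof (rule CMC_choice[OF assms not_fin_omega ctbl_omega])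
    show "definable_fun ?B" by (intro definable_intros definable_fun_comp[OF u])
    fix n assume n: "n \<epsilon> omega"
    \<comment> \<open>This enumeration is obtained for each \<open>n\<close> separately and only
      shows that \<open>?B n\<close> is nonempty.\<close>
    obtain h where h: "definable_fun h" "\<And>y. y \<epsilon> u n \<longleftrightarrow> (\<exists>m. m \<epsilon> omega \<and> y = h m)"
      using ctbl_surj un[OF n] by metis
    have "lam omega h \<epsilon> ?B n"
      unfolding B using h(2) by (auto simp: sub_def mem_lam[OF h(1)] is_fun_lam[OF h(1)])
    then show "\<exists>f. f \<epsilon> ?B n" by blast
  qed auto
  have C_app: "y \<epsilon> u n \<longleftrightarrow> (\<exists>m. m \<epsilon> omega \<and> y = app f m)" if "n \<epsilon> omega" "f \<epsilon> C n" for n f y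
  proof -
    have "f \<epsilon> ?B n" using C(2) that by (auto simp: sub_def)
    then show ?thesis unfolding B using app_eq by blast
  qed
  let ?F = "\<lambda>n m. Img (C n) (\<lambda>f. app f m)" and ?v = "\<lambda>n m. BigUn (Img (C n) (\<lambda>f. app f m))"
  have app: "definable_fun (\<lambda>f. app f m)" for m by (intro definable_intros)
  note F = mem_Img_fun[OF app]
  have "resolves True \<A> u ?v"
    unfolding resolves_def
  proof (intro conjI allI impI)
    show "definable_fun2 ?v" by (intro definable_intros definable_fun_comp[OF C(1)])
  next
    fix n m assume nm: "n \<epsilon> omega" "m \<epsilon> omega"
    \<comment> \<open>Evaluating all enumerations in \<open>C n\<close> at \<open>m\<close> gives a
      nonempty finite set of members of \<open>\<A>\<close>, whose union is again a member.\<close>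
    obtain f where "f \<epsilon> C n" using C(2) nm by blast
    then have "app f m \<epsilon> ?F n m" by (auto simp: F)
    moreover have "sub (?F n m) \<A>"
      using C_app[OF nm(1)] un[OF nm(1)] nm(2) by (auto simp: sub_def F)
    moreover have "fin (?F n m)" using C(2) nm by (intro fin_Img app) blast
    ultimately show "?v n m \<epsilon> \<A>" using stable by (intro BigUn_stable)
  next
    fix n z assume n: "n \<epsilon> omega"
    then obtain f where f: "f \<epsilon> C n" using C(2) by blast
    \<comment> \<open>A single enumeration in \<open>C n\<close> already covers the union of
      \<open>u n\<close>; conversely, every value of every enumeration in \<open>C n\<close> belongs
      to \<open>u n\<close>.\<close>
    show "big_op True (\<lambda>y. y \<epsilon> u n) z \<longleftrightarrow> big_op True (\<lambda>y. \<exists>m. m \<epsilon> omega \<and> y = ?v n m) z"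
    proof
      assume "big_op True (\<lambda>y. y \<epsilon> u n) z"
      then obtain y where y: "y \<epsilon> u n" "z \<epsilon> y" by (auto simp: big_op_def)
      then obtain m where m: "m \<epsilon> omega" "y = app f m" using C_app[OF n f] by blast
      then have "z \<epsilon> ?v n m" using y f by (auto simp: F)
      then show "big_op True (\<lambda>y. \<exists>m. m \<epsilon> omega \<and> y = ?v n m) z"
        using m(1) unfolding big_op_def if_True by blast
    next
      assume "big_op True (\<lambda>y. \<exists>m. m \<epsilon> omega \<and> y = ?v n m) z"
      then obtain m g where "m \<epsilon> omega" "g \<epsilon> C n" "z \<epsilon> app g m" by (auto simp: big_op_def F)
      then show "big_op True (\<lambda>y. y \<epsilon> u n) z" using C_app[OF n] by (auto simp: big_op_def)
    qed
  qed
  then show "\<exists>v. resolves True \<A> u v" by blast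
qed

section \<open>Implication (iii)\<close>

lemma A_sigma_sigma_imp_CMC_omega:
  assumes "A_sem True"
  shows "sats e (CMC_omega d)"
proof (rule CMC_omegaI)
  fix J F
  assume F: "definable_fun F" and J: "\<not> fin J" "ctbl J"
    and FJ: "\<And>j. j \<epsilon> J \<Longrightarrow> \<not> fin (F j) \<and> ctbl (F j)"
  have nonempty: "\<exists>z. z \<epsilon> x" if "\<not> fin x" for x
    using that eq_emp[of x] fin_emp by metis
  obtain h where h: "definable_fun h" "\<And>j. j \<epsilon> J \<longleftrightarrow> (\<exists>n. n \<epsilon> omega \<and> j = h n)"
    using ctbl_surj[OF J(2)] nonempty[OF J(1)] by metis
  let ?X = "BigUn (Img J F)"
  \<comment> \<open>Membership in this lattice makes each \<open>v n m\<close> finite, while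
    containment in \<open>F (h n)\<close> will come from the union equation. The empty set belongs
    to the lattice, hence the search for a nonempty term below.\<close>
  let ?A = "Sep (Pw ?X) fin"
  let ?s = "\<lambda>x. upair x x"
  let ?u = "\<lambda>n. Img (F (h n)) ?s"
  have s: "definable_fun ?s" by (intro definable_intros)
  have A: "A \<epsilon> ?A \<longleftrightarrow> sub A ?X \<and> fin A" for A
    using mem_Sep[of fin A "Pw ?X"] by (simp add: definable_intros)
  have "admissible ?X ?A ?u"
    unfolding admissible_def
  proof (intro conjI allI impI)
    show "definable_fun ?u"
      by (intro definable_intros definable_fun_comp[OF F] definable_fun_comp[OF h(1)])
    show "sub A ?X" if "A \<epsilon> ?A" for A using that by (simp add: A)
    show "cup A B \<epsilon> ?A" if "A \<epsilon> ?A" "B \<epsilon> ?A" for A B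
      using that fin_cup unfolding A by (auto simp: sub_def)
    show "cap A B \<epsilon> ?A" if "A \<epsilon> ?A" "B \<epsilon> ?A" for A B
      using that fin_sub[of A "cap A B"] unfolding A by (auto simp: sub_def)
    fix n assume "n \<epsilon> omega"
    then have n: "h n \<epsilon> J" using h(2) by blast
    show "\<exists>z. z \<epsilon> ?u n"
      using nonempty FJ[OF n] by (auto simp: mem_Img_fun[OF s])
    show "ctbl (?u n)"
      using FJ[OF n] s by (intro ctbl_Img) (auto simp: inj_on_def upair_inject)
    show "sub (?u n) ?A"
      unfolding sub_def A using n by (auto simp: mem_Img_fun[OF s] mem_Img_fun[OF F] fin_singleton)
  qed
  then obtain v where "resolves True ?A ?u v" by (rule A_semD[OF assms])
  then have v: "definable_fun2 v" "\<And>n m. n \<epsilon> omega \<Longrightarrow> m \<epsilon> omega \<Longrightarrow> v n m \<epsilon> ?A"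
    "\<And>n z. n \<epsilon> omega \<Longrightarrow> big_op True (\<lambda>y. y \<epsilon> ?u n) z \<longleftrightarrow> big_op True (\<lambda>y. \<exists>m. m \<epsilon> omega \<and> y = v n m) z"
    unfolding resolves_def by simp_all
  \<comment> \<open>The union of the singletons of the elements of a set is the set itself, so row
    \<open>n\<close> of \<open>v\<close> has union \<open>F (h n)\<close>.\<close>
  have F_v: "z \<epsilon> F (h n) \<longleftrightarrow> (\<exists>m. m \<epsilon> omega \<and> z \<epsilon> v n m)" if "n \<epsilon> omega" for n z
    using v(3)[OF that, of z] by (auto simp: big_op_def mem_Img_fun[OF s])
  \<comment> \<open>An index \<open>j\<close> can occur several times in the enumeration. Taking its
    first occurrence, and then the first nonempty term of that row, makes the selected set a
    definable function of \<open>j\<close>.\<close>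
  let ?n = "\<lambda>j. least (\<lambda>n. h n = j)"
  let ?m = "\<lambda>n. least (\<lambda>m. \<exists>z. z \<epsilon> v n m)"
  let ?C = "\<lambda>j. v (?n j) (?m (?n j))"
  have dn: "definable_fun ?n" by (intro definable_intros definable_fun_comp[OF h(1)])
  have dm: "definable_fun ?m" by (intro definable_intros definable_fun2_comp[OF v(1)])
  have C: "definable_fun ?C"
    by (rule definable_fun2_comp[OF v(1) dn definable_fun_comp[OF dm dn]])
  have "(\<exists>z. z \<epsilon> ?C j) \<and> fin (?C j) \<and> sub (?C j) (F j)" if j: "j \<epsilon> J" for j
  proof -
    obtain n where "n \<epsilon> omega" "h n = j" using h(2)[of j] j by auto
    moreover have "definable (\<lambda>e. h (e 0) = j)"
      by (intro definable_intros definable_fun_comp[OF h(1)])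
    ultimately have n: "?n j \<epsilon> omega" "h (?n j) = j" by (auto intro: least)
    obtain z where "z \<epsilon> F j" using nonempty FJ[OF j] by blast
    then obtain m where "m \<epsilon> omega" "\<exists>z. z \<epsilon> v (?n j) m" using F_v[OF n(1)] n(2) by auto
    moreover have "definable (\<lambda>e. \<exists>z. z \<epsilon> v (?n j) (e 0))"
      by (intro definable_intros definable_fun2_comp[OF v(1)])
    ultimately have m: "?m (?n j) \<epsilon> omega" "\<exists>z. z \<epsilon> ?C j"
      using least[of "\<lambda>m. \<exists>z. z \<epsilon> v (?n j) m"] by blast+
    moreover have "fin (?C j)" using v(2)[OF n(1) m(1)] unfolding A by blast
    moreover have "sub (?C j) (F j)" using F_v[OF n(1)] n(2) m(1) by (auto simp: sub_def)
    ultimately show ?thesis by blast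
  qed
  then show "\<exists>C. definable_fun C \<and> (\<forall>j. j \<epsilon> J \<longrightarrow> (\<exists>z. z \<epsilon> C j) \<and> fin (C j) \<and> sub (C j) (F j))"
    by (intro exI[of _ ?C] conjI[OF C] allI impI)
qed

end

theorem theorem2p9:
  shows "ZF \<turnstile> (A_sigma_sigma \<^bold>\<longleftrightarrow> A_delta_delta) 0
    \<and> ZF \<turnstile> (CMC \<^bold>\<longrightarrow> A_sigma_sigma) 0
    \<and> ZF \<turnstile> (A_sigma_sigma \<^bold>\<longrightarrow> CMC_omega) 0"
proof (intro conjI ZF_completeness)
  show "fv_bound ((A_sigma_sigma \<^bold>\<longleftrightarrow> A_delta_delta) 0) = 0"
    "fv_bound ((CMC \<^bold>\<longrightarrow> A_sigma_sigma) 0) = 0"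
    "fv_bound ((A_sigma_sigma \<^bold>\<longrightarrow> CMC_omega) 0) = 0"
    by code_simp+
next
  fix E :: "nat \<Rightarrow> nat \<Rightarrow> bool" and e
  assume "zf_model E"
  then interpret zf_model E .
  show "sats e ((A_sigma_sigma \<^bold>\<longleftrightarrow> A_delta_delta) 0)"
    using A_sem_dual[of True] A_sem_dual[of False]
    by (auto simp: sat_A_sigma_sigma sat_A_delta_delta)
  show "sats e ((CMC \<^bold>\<longrightarrow> A_sigma_sigma) 0)"
    using CMC_imp_A_sigma_sigma by (simp add: sat_A_sigma_sigma)
  show "sats e ((A_sigma_sigma \<^bold>\<longrightarrow> CMC_omega) 0)"
    using A_sigma_sigma_imp_CMC_omega by (simp add: sat_A_sigma_sigma)
qed

end
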